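(* Let $M$ be a compact manifold with a Riemannian metric $g_0$, let $\mathcal F$ be a (non-singular) Riemannian foliation on $(M,g_0)$ with totally geodesic leaves, and let $\phi:M\to\mathbb R$ be a basic function. Let $g_\phi$ be the metric defined by $$g_\phi(X+\xi,X+\xi)=g_0(X,X)+e^{2\phi}g_0(\xi,\xi)$$ for $X$ horizontal and $\xi$ vertical. If $g_\phi$ has positive sectional curvature, then $\mathcal F$ has a fat point, i.e., there is a point $p\in M$ such that $A_X^*\xi\neq 0$ for all non-zero horizontal $X\in\mathcal H_p$ and all non-zero vertical $\xi\in\mathcal V_p$.
   Context: A foliation $\mathcal F$ on $(M,g_0)$ is Riemannian if its leaves are locally equidistant (equivalently, $\mathcal F$ is locally given by the fibers of a Riemannian submersion). All foliations are non-singular: all leaves have the same dimension. $\mathcal V$ is the bundle of vertical vectors (tangent to leaves) and $\mathcal H$ its $g_0$-orthogonal complement, the bundle of horizontal vectors (it is also the $g_\phi$-orthogonal complement). A basic function is a smooth function that is constant along the leaves. For $X,Y$ horizontal (extended to horizontal fields), $A_XY=\tfrac12[X,Y]^v$ is the O'Neill tensor, where $^v$ is the orthogonal projection to $\mathcal V$; $A^*_X:\mathcal V\to\mathcal H$ is the adjoint, $\langle A^*_X\xi,Y\rangle=\langle\xi,A_XY\rangle$ (whether it vanishes does not depend on using $g_0$ or $g_\phi$). *)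

theory Defs
  imports "HOL-Analysis.Analysis"
begin

section \<open>Smooth maps between Euclidean spaces\<close>

text \<open>Used for open sets \<open>S\<close> only. \<open>ck_on k S f\<close> says that \<open>f\<close> is \<open>k\<close> times continuously
  differentiable on \<open>S\<close>; continuity of the lower derivatives is implied by differentiability.\<close>

primrec ck_on ::
  "nat \<Rightarrow> 'a::euclidean_space set \<Rightarrow> ('a \<Rightarrow> 'b::real_normed_vector) \<Rightarrow> bool" where
  "ck_on 0 S f \<longleftrightarrow> continuous_on S f"
| "ck_on (Suc k) S f \<longleftrightarrow>
     (\<forall>x\<in>S. f differentiable (at x)) \<and> (\<forall>v. ck_on k S (\<lambda>x. frechet_derivative f (at x) v))"

definition smooth_on :: "'a::euclidean_space set \<Rightarrow> ('a \<Rightarrow> 'b::real_normed_vector) \<Rightarrow> bool" where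
  "smooth_on S f \<longleftrightarrow> (\<forall>k. ck_on k S f)"

definition inner_product_on :: "'a::real_vector set \<Rightarrow> ('a \<Rightarrow> 'a \<Rightarrow> real) \<Rightarrow> bool" where
  "inner_product_on Q b \<longleftrightarrow>
     (\<forall>u\<in>Q. \<forall>v\<in>Q. b u v = b v u) \<and>
     (\<forall>u\<in>Q. \<forall>v\<in>Q. \<forall>w\<in>Q. b (u + v) w = b u w + b v w) \<and>
     (\<forall>u\<in>Q. \<forall>v\<in>Q. \<forall>r. b (r *\<^sub>R u) v = r * b u v) \<and>
     (\<forall>u\<in>Q. u \<noteq> 0 \<longrightarrow> 0 < b u u)"


section \<open>Smooth manifolds\<close>

text \<open>The manifold is the type \<open>'m\<close>, of dimension \<open>DIM('e)\<close>. A chart is a pair of a domain and a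
  coordinate map; the values of the map outside the domain are irrelevant.\<close>

type_synonym ('m, 'e) chart = "'m set \<times> ('m \<Rightarrow> 'e)"

definition is_chart :: "('m::topological_space, 'e::euclidean_space) chart \<Rightarrow> bool" where
  "is_chart c \<longleftrightarrow> open (fst c) \<and> open (snd c ` fst c) \<and>
     (\<exists>c'. homeomorphism (fst c) (snd c ` fst c) (snd c) c')"

definition img :: "('m, 'e) chart \<Rightarrow> 'e set" where
  "img c = snd c ` fst c"

definition param :: "('m, 'e) chart \<Rightarrow> 'e \<Rightarrow> 'm" where
  "param c = inv_into (fst c) (snd c)"

definition overlap :: "('m, 'e) chart \<Rightarrow> ('m, 'e) chart \<Rightarrow> 'e set" where
  "overlap c d = snd c ` (fst c \<inter> fst d)"

definition transition :: "('m, 'e) chart \<Rightarrow> ('m, 'e) chart \<Rightarrow> 'e \<Rightarrow> 'e" where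
  "transition c d = snd d \<circ> param c"

definition compatible ::
  "('m, 'e::euclidean_space) chart \<Rightarrow> ('m, 'e) chart \<Rightarrow> bool" where
  "compatible c d \<longleftrightarrow>
     smooth_on (overlap c d) (transition c d) \<and> smooth_on (overlap d c) (transition d c)"

text \<open>A smooth structure is a maximal smooth atlas.\<close>

definition smooth_structure :: "('m::topological_space, 'e::euclidean_space) chart set \<Rightarrow> bool" where
  "smooth_structure A \<longleftrightarrow>
     (\<forall>c\<in>A. is_chart c) \<and> (\<Union>c\<in>A. fst c) = UNIV \<and>
     (\<forall>c\<in>A. \<forall>d\<in>A. compatible c d) \<and>
     (\<forall>c. is_chart c \<and> (\<forall>d\<in>A. compatible c d) \<longrightarrow> c \<in> A)"

definition smooth_function ::
  "('m, 'e::euclidean_space) chart set \<Rightarrow> ('m \<Rightarrow> real) \<Rightarrow> bool" where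
  "smooth_function A f \<longleftrightarrow> (\<forall>c\<in>A. smooth_on (img c) (f \<circ> param c))"


section \<open>Riemannian metrics\<close>

text \<open>A tangent vector at \<open>p\<close> is represented in a chart \<open>c\<close> around \<open>p\<close> by its coordinate vector
  in \<open>'e\<close>; coordinate vectors \<open>u\<close> in \<open>c\<close> and \<open>v\<close> in \<open>d\<close> represent the same tangent vector iff the
  derivative of \<open>transition c d\<close> maps \<open>u\<close> to \<open>v\<close>. A metric \<open>g\<close> on the manifold is given by its
  coordinate expressions \<open>g c x u v\<close> in all charts; a metric on an open subset of \<open>'e\<close> has
  the type \<open>'e local_metric\<close>.\<close>

type_synonym 'e local_metric = "'e \<Rightarrow> 'e \<Rightarrow> 'e \<Rightarrow> real"

definition local_riemannian_metric :: "'e::euclidean_space set \<Rightarrow> 'e local_metric \<Rightarrow> bool" where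
  "local_riemannian_metric S G \<longleftrightarrow>
     (\<forall>x\<in>S. inner_product_on UNIV (G x)) \<and> (\<forall>u v. smooth_on S (\<lambda>x. G x u v))"

definition riemannian_metric ::
  "('m, 'e::euclidean_space) chart set \<Rightarrow> (('m, 'e) chart \<Rightarrow> 'e local_metric) \<Rightarrow> bool" where
  "riemannian_metric A g \<longleftrightarrow>
     (\<forall>c\<in>A. local_riemannian_metric (img c) (g c)) \<and>
     (\<forall>c\<in>A. \<forall>d\<in>A. \<forall>x\<in>overlap c d. \<forall>u v.
        g c x u v = g d (transition c d x)
          (frechet_derivative (transition c d) (at x) u)
          (frechet_derivative (transition c d) (at x) v))"

text \<open>Christoffel map of the Levi-Civita connection: the Koszul formula for the constant
  coordinate fields \<open>u\<close>, \<open>v\<close>, \<open>z\<close>, whose brackets vanish.\<close>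

definition christoffel :: "'e::euclidean_space local_metric \<Rightarrow> 'e \<Rightarrow> 'e \<Rightarrow> 'e \<Rightarrow> 'e" where
  "christoffel G x u v = (THE w. \<forall>z. 2 * G x w z =
       frechet_derivative (\<lambda>y. G y v z) (at x) u
     + frechet_derivative (\<lambda>y. G y u z) (at x) v
     - frechet_derivative (\<lambda>y. G y u v) (at x) z)"

definition levi_civita ::
  "'e::euclidean_space local_metric \<Rightarrow> ('e \<Rightarrow> 'e) \<Rightarrow> ('e \<Rightarrow> 'e) \<Rightarrow> 'e \<Rightarrow> 'e" where
  "levi_civita G X Y x = frechet_derivative Y (at x) (X x) + christoffel G x (X x) (Y x)"

definition curvature :: "'e::euclidean_space local_metric \<Rightarrow> 'e \<Rightarrow> 'e \<Rightarrow> 'e \<Rightarrow> 'e \<Rightarrow> 'e" where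
  "curvature G x u v w =
     levi_civita G (\<lambda>_. u) (levi_civita G (\<lambda>_. v) (\<lambda>_. w)) x
   - levi_civita G (\<lambda>_. v) (levi_civita G (\<lambda>_. u) (\<lambda>_. w)) x"

definition sectional_curvature :: "'e::euclidean_space local_metric \<Rightarrow> 'e \<Rightarrow> 'e \<Rightarrow> 'e \<Rightarrow> real" where
  "sectional_curvature G x u v =
     G x (curvature G x u v v) u / (G x u u * G x v v - (G x u v)\<^sup>2)"

definition positive_sectional_curvature ::
  "('m, 'e::euclidean_space) chart set \<Rightarrow> (('m, 'e) chart \<Rightarrow> 'e local_metric) \<Rightarrow> bool" where
  "positive_sectional_curvature A g \<longleftrightarrow>
     (\<forall>c\<in>A. \<forall>x\<in>img c. \<forall>u v. u \<noteq> v \<and> independent {u, v} \<longrightarrow>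
        0 < sectional_curvature (g c) x u v)"


section \<open>Foliations\<close>

text \<open>A foliation with leaves of dimension \<open>dim W\<close> is given by an atlas of foliated charts, whose
  plaques are the connected pieces of the translates of the model subspace \<open>W\<close>. The last condition
  says that transition maps locally have the form \<open>(a, b) \<mapsto> (h a, k a b)\<close> with respect to the
  splitting of \<open>'e\<close> into a complement of \<open>W\<close> and \<open>W\<close>. The subspace \<open>W\<close> may be zero or everything.\<close>

definition foliation ::
  "('m, 'e::euclidean_space) chart set \<Rightarrow> 'e set \<Rightarrow> ('m, 'e) chart set \<Rightarrow> bool" where
  "foliation A W F \<longleftrightarrow>
     subspace W \<and> F \<subseteq> A \<and> (\<Union>c\<in>F. fst c) = UNIV \<and>
     (\<forall>c\<in>F. \<forall>d\<in>F. \<forall>x\<in>overlap c d. \<exists>N. open N \<and> x \<in> N \<and> N \<subseteq> overlap c d \<and>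
        (\<forall>y\<in>N. \<forall>z\<in>N. y - z \<in> W \<longrightarrow> transition c d y - transition c d z \<in> W))"

definition plaque ::
  "'e::euclidean_space set \<Rightarrow> ('m::topological_space, 'e) chart \<Rightarrow> 'm \<Rightarrow> 'm set" where
  "plaque W c p = connected_component_set {q \<in> fst c. snd c q - snd c p \<in> W} p"

definition leaf ::
  "'e::euclidean_space set \<Rightarrow> ('m::topological_space, 'e) chart set \<Rightarrow> 'm \<Rightarrow> 'm set" where
  "leaf W F p = {(q, r). \<exists>c\<in>F. q \<in> fst c \<and> r \<in> plaque W c q}\<^sup>* `` {p}"

definition basic_function ::
  "('m::topological_space, 'e::euclidean_space) chart set \<Rightarrow> 'e set \<Rightarrow> ('m, 'e) chart set
    \<Rightarrow> ('m \<Rightarrow> real) \<Rightarrow> bool" where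
  "basic_function A W F f \<longleftrightarrow>
     smooth_function A f \<and> (\<forall>p. \<forall>q\<in>leaf W F p. f q = f p)"

text \<open>Tangent space of the leaf through the point with coordinates \<open>x\<close>, in the coordinates of an
  arbitrary chart \<open>c\<close>: in foliated charts it is \<open>W\<close>.\<close>

definition vertical ::
  "'e::euclidean_space set \<Rightarrow> ('m, 'e) chart set \<Rightarrow> ('m, 'e) chart \<Rightarrow> 'e \<Rightarrow> 'e set" where
  "vertical W F c x =
     {u. \<forall>d\<in>F. x \<in> overlap c d \<longrightarrow> frechet_derivative (transition c d) (at x) u \<in> W}"


subsection \<open>Distributions on open subsets of the model space\<close>

definition horizontal ::
  "'e::euclidean_space local_metric \<Rightarrow> ('e \<Rightarrow> 'e set) \<Rightarrow> 'e \<Rightarrow> 'e set" where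
  "horizontal G V x = {u. \<forall>w\<in>V x. G x u w = 0}"

definition vpart ::
  "'e::euclidean_space local_metric \<Rightarrow> ('e \<Rightarrow> 'e set) \<Rightarrow> 'e \<Rightarrow> 'e \<Rightarrow> 'e" where
  "vpart G V x u = (THE w. w \<in> V x \<and> u - w \<in> horizontal G V x)"

definition hpart ::
  "'e::euclidean_space local_metric \<Rightarrow> ('e \<Rightarrow> 'e set) \<Rightarrow> 'e \<Rightarrow> 'e \<Rightarrow> 'e" where
  "hpart G V x u = u - vpart G V x u"

definition lie_bracket ::
  "('e::euclidean_space \<Rightarrow> 'e) \<Rightarrow> ('e \<Rightarrow> 'e) \<Rightarrow> 'e \<Rightarrow> 'e" where
  "lie_bracket X Y x = frechet_derivative Y (at x) (X x) - frechet_derivative X (at x) (Y x)"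

text \<open>The O'Neill tensor \<open>A\<^sub>u v\<close> for horizontal \<open>u\<close>, \<open>v\<close>, which are extended to horizontal fields
  by projecting constant coordinate fields. The choice of the horizontal extensions \<open>X\<close>, \<open>Y\<close> does
  not matter: differentiating \<open>P Y = 0\<close>, where \<open>P\<close> is the vertical projection, gives
  \<open>P (D\<^sub>X Y) = - (D\<^sub>X P) Y\<close>, which depends only on the values of \<open>X\<close> and \<open>Y\<close> at the point.\<close>

definition oneill ::
  "'e::euclidean_space local_metric \<Rightarrow> ('e \<Rightarrow> 'e set) \<Rightarrow> 'e \<Rightarrow> 'e \<Rightarrow> 'e \<Rightarrow> 'e" where
  "oneill G V x u v =
     (1/2) *\<^sub>R vpart G V x (lie_bracket (\<lambda>y. hpart G V y u) (\<lambda>y. hpart G V y v) x)"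

definition oneill_adjoint ::
  "'e::euclidean_space local_metric \<Rightarrow> ('e \<Rightarrow> 'e set) \<Rightarrow> 'e \<Rightarrow> 'e \<Rightarrow> 'e \<Rightarrow> 'e" where
  "oneill_adjoint G V x u w =
     (THE z. z \<in> horizontal G V x \<and>
        (\<forall>v\<in>horizontal G V x. G x z v = G x w (oneill G V x u v)))"

text \<open>A Riemannian submersion from \<open>(S, G)\<close> onto the open subset \<open>\<pi> ` S\<close> of the vector space \<open>Q\<close>
  with the metric \<open>h\<close>. Since \<open>\<pi>\<close> is a submersion, smoothness of \<open>h\<close> on the base can be (and is)
  stated as smoothness of its composition with \<open>\<pi>\<close>.\<close>

definition riemannian_submersion ::
  "'e::euclidean_space set \<Rightarrow> 'e local_metric \<Rightarrow> 'e set \<Rightarrow> 'e local_metric \<Rightarrow> ('e \<Rightarrow> 'e) \<Rightarrow> bool"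
where
  "riemannian_submersion S G Q h \<pi> \<longleftrightarrow>
     smooth_on S \<pi> \<and> \<pi> ` S \<subseteq> Q \<and>
     (\<forall>x\<in>S. range (frechet_derivative \<pi> (at x)) = Q) \<and>
     (\<forall>y\<in>\<pi> ` S. inner_product_on Q (h y)) \<and>
     (\<forall>u\<in>Q. \<forall>v\<in>Q. smooth_on S (\<lambda>x. h (\<pi> x) u v)) \<and>
     (\<forall>x\<in>S. let D = frechet_derivative \<pi> (at x); H = horizontal G (\<lambda>_. {w. D w = 0}) x in
        \<forall>u\<in>H. \<forall>v\<in>H. h (\<pi> x) (D u) (D v) = G x u v)"


subsection \<open>Riemannian foliations with totally geodesic leaves\<close>

text \<open>The foliation is locally given by the fibers of a Riemannian submersion, i.e. its leaves and the
  fibers have the same tangent spaces. The base has dimension \<open>DIM('e) - dim W\<close>; locally it is an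
  open subset of the orthogonal complement of \<open>W\<close>.\<close>

definition riemannian_foliation ::
  "('m, 'e::euclidean_space) chart set \<Rightarrow> 'e set \<Rightarrow> ('m, 'e) chart set
    \<Rightarrow> (('m, 'e) chart \<Rightarrow> 'e local_metric) \<Rightarrow> bool" where
  "riemannian_foliation A W F g \<longleftrightarrow> foliation A W F \<and>
     (\<forall>p. \<exists>c\<in>A. p \<in> fst c \<and>
        (\<exists>\<pi> h. riemannian_submersion (img c) (g c) (orthogonal_comp W) h \<pi> \<and>
           (\<forall>x\<in>img c. {u. frechet_derivative \<pi> (at x) u = 0} = vertical W F c x)))"

text \<open>Vanishing second fundamental form of the leaves: covariant derivatives of vertical fields
  in vertical directions are vertical.\<close>

definition totally_geodesic_leaves ::
  "('m, 'e::euclidean_space) chart set \<Rightarrow> 'e set \<Rightarrow> ('m, 'e) chart set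
    \<Rightarrow> (('m, 'e) chart \<Rightarrow> 'e local_metric) \<Rightarrow> bool" where
  "totally_geodesic_leaves A W F g \<longleftrightarrow>
     (\<forall>c\<in>A. \<forall>S X Y. open S \<and> S \<subseteq> img c \<and> smooth_on S X \<and> smooth_on S Y \<and>
        (\<forall>x\<in>S. X x \<in> vertical W F c x \<and> Y x \<in> vertical W F c x) \<longrightarrow>
        (\<forall>x\<in>S. levi_civita (g c) X Y x \<in> vertical W F c x))"

definition rescaled_metric ::
  "'e::euclidean_space set \<Rightarrow> ('m, 'e) chart set \<Rightarrow> (('m, 'e) chart \<Rightarrow> 'e local_metric)
    \<Rightarrow> ('m \<Rightarrow> real) \<Rightarrow> ('m, 'e) chart \<Rightarrow> 'e local_metric" where
  "rescaled_metric W F g \<phi> c x u v =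
     (let V = vertical W F c in
        g c x (hpart (g c) V x u) (hpart (g c) V x v)
      + exp (2 * \<phi> (param c x)) * g c x (vpart (g c) V x u) (vpart (g c) V x v))"

definition fat_point ::
  "('m, 'e::euclidean_space) chart set \<Rightarrow> 'e set \<Rightarrow> ('m, 'e) chart set
    \<Rightarrow> (('m, 'e) chart \<Rightarrow> 'e local_metric) \<Rightarrow> 'm \<Rightarrow> bool" where
  "fat_point A W F g p \<longleftrightarrow>
     (\<forall>c\<in>A. p \<in> fst c \<longrightarrow>
        (let x = snd c p; V = vertical W F c in
           \<forall>u\<in>horizontal (g c) V x. \<forall>w\<in>V x. u \<noteq> 0 \<and> w \<noteq> 0 \<longrightarrow>
             oneill_adjoint (g c) V x u w \<noteq> 0))"

end

theory Submission
  imports Defs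
begin

text \<open>At a minimum \<open>p\<close> of \<open>\<phi>\<close> the manifold has a fat point. Suppose \<open>u\<close> is horizontal and \<open>w\<close> vertical at
  \<open>p\<close>, extend \<open>u\<close> to a basic field \<open>X\<close> and \<open>w\<close> to a vertical field \<open>\<xi>\<close>, and put \<open>f = e\<^sup>2\<^sup>\<phi>\<close>. By the Koszul
  formula and since the leaves are totally geodesic for \<open>g\<^sub>0\<close>, the vertical part of \<open>\<nabla>\<^sub>\<xi> X\<close> with respect to
  \<open>g\<^sub>\<phi>\<close> is governed by \<open>2 g\<^sub>\<phi>(\<nabla>\<^sub>\<xi> X, \<eta>) = (X f) g\<^sub>0(\<xi>, \<eta>)\<close>, and its horizontal part is \<open>- A\<^sup>*\<^sub>X \<xi>\<close>
  (adjoint with respect to \<open>g\<^sub>\<phi>\<close>).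
  As \<open>df = 0\<close> at \<open>p\<close>, the curvature term \<open>g\<^sub>\<phi>(R(w, u) u, w)\<close> equals
  \<open>|A\<^sup>*\<^sub>u w|\<^sup>2 - Hess f (u, u) g\<^sub>0(w, w) / 2\<close>, where the last term is not positive at a minimum.
  Hence positive curvature forces \<open>A\<^sup>*\<^sub>u w \<noteq> 0\<close>.\<close>

section \<open>Calculus of smooth maps\<close>

text \<open>No general curvature formula is derived: \<open>A\<^sup>*\<close> is assumed to vanish
  on one pair u, w, and each term of the curvature is then shown to be zero or of the right sign.
  The field X is basic because its inner products with basic fields are then constant along the
  leaves and its brackets with vertical fields are vertical, which empties most of the Koszul
  formula. The Hessian appears by differentiating X f, so the formula for the vertical part is
  needed near p and not just at p.

  Two obstacles shape the rest. Christoffel maps and horizontal lifts are definite descriptions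
  whose smoothness has to be proved; both solve linear equations
  \<open>G y (w y) z = \<kappa> y z\<close> with a parameter y, and one regularity result for such
  equations serves both. The base metric h is known to be smooth only after composition with \<pi>,
  so its constancy along the leaves is differentiated by an open mapping argument instead of a chain
  rule. Finally, the submersion is given in one chart around p but fatness is a condition in all
  charts, hence the transport along transition maps.\<close>

abbreviation fd :: "('a::real_normed_vector \<Rightarrow> 'b::real_normed_vector) \<Rightarrow> 'a \<Rightarrow> 'a \<Rightarrow> 'b" where
  "fd f x \<equiv> frechet_derivative f (at x)"

lemma fd_eqI: "(f has_derivative f') (at x) \<Longrightarrow> fd f x v = f' v"
  using frechet_derivative_at by metis

lemma has_derivative_fd: "f differentiable (at x) \<Longrightarrow> (f has_derivative fd f x) (at x)"
  by (simp add: frechet_derivative_works)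

lemma linear_fd: "f differentiable (at x) \<Longrightarrow> linear (fd f x)"
  by (rule linear_frechet_derivative)

text \<open>No differentiability is required: \<open>frechet_derivative\<close> chooses from the set
  of all derivatives, and that set is the same for both functions.\<close>

lemma fd_cong:
  assumes "open S" "x \<in> S" "\<And>y. y \<in> S \<Longrightarrow> f y = g y"
  shows "fd f x = fd g x"
proof -
  have "(f has_derivative d) (at x) \<longleftrightarrow> (g has_derivative d) (at x)" for d
    using has_derivative_transform_within_open[OF _ assms(1,2)] assms(3) by metis
  then show ?thesis
    by (simp add: frechet_derivative_def)
qed

lemma differentiable_cong:
  assumes "open S" "x \<in> S" "\<And>y. y \<in> S \<Longrightarrow> f y = g y" "g differentiable (at x)"
  shows "f differentiable (at x)"
  using assms has_derivative_transform_within_open[of g _ x UNIV S f] unfolding differentiable_def by metis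

lemma fd_bilinear:
  assumes "bounded_bilinear pr" "f differentiable (at x)" "g differentiable (at x)"
  shows "fd (\<lambda>y. pr (f y) (g y)) x v = pr (f x) (fd g x v) + pr (fd f x v) (g x)"
    and "(\<lambda>y. pr (f y) (g y)) differentiable (at x)"
  using bounded_bilinear.FDERIV[OF assms(1) has_derivative_fd has_derivative_fd, OF assms(2,3)]
  by (auto intro: fd_eqI simp: differentiable_def)

lemma fd_bounded_linear:
  assumes "bounded_linear L" "f differentiable (at x)"
  shows "fd (\<lambda>y. L (f y)) x v = L (fd f x v)"
    and "(\<lambda>y. L (f y)) differentiable (at x)"
  using bounded_linear.has_derivative[OF assms(1) has_derivative_fd[OF assms(2)]]
  by (auto intro: fd_eqI simp: differentiable_def)

lemma fd_inner:
  assumes "f differentiable (at x)"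
  shows "fd (\<lambda>y. f y \<bullet> b) x v = fd f x v \<bullet> b" and "(\<lambda>y. f y \<bullet> b) differentiable (at x)"
  using fd_bounded_linear[OF bounded_linear_inner_left assms] by blast+

lemma fd_add:
  assumes "f differentiable (at x)" "g differentiable (at x)"
  shows "fd (\<lambda>y. f y + g y) x v = fd f x v + fd g x v"
  using has_derivative_add[OF has_derivative_fd has_derivative_fd, OF assms] by (rule fd_eqI)

lemma fd_sum:
  assumes "\<And>i. i \<in> I \<Longrightarrow> f i differentiable (at x)"
  shows "fd (\<lambda>y. \<Sum>i\<in>I. f i y) x v = (\<Sum>i\<in>I. fd (f i) x v)"
  using has_derivative_sum[OF has_derivative_fd, OF assms] by (rule fd_eqI)

lemma fd_scaleR:
  assumes "f differentiable (at x)" "g differentiable (at x)"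
  shows "fd (\<lambda>y. f y *\<^sub>R g y) x v = f x *\<^sub>R fd g x v + fd f x v *\<^sub>R g x"
  by (rule fd_bilinear[OF bounded_bilinear_scaleR assms])

lemma fd_compose:
  assumes "g differentiable (at x)" "f differentiable (at (g x))"
  shows "fd (\<lambda>y. f (g y)) x v = fd f (g x) (fd g x v)"
    and "(\<lambda>y. f (g y)) differentiable (at x)"
  using has_derivative_compose[OF has_derivative_fd has_derivative_fd, OF assms]
  by (auto intro: fd_eqI simp: differentiable_def)

lemma differentiable_componentwise:
  fixes f :: "'a::real_normed_vector \<Rightarrow> 'b::euclidean_space"
  assumes "\<And>b. b \<in> Basis \<Longrightarrow> (\<lambda>y. f y \<bullet> b) differentiable (at x)"
  shows "f differentiable (at x)"
proof -
  have "(\<lambda>y. \<Sum>b\<in>Basis. (f y \<bullet> b) *\<^sub>R b) differentiable (at x)"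
    using assms by (intro differentiable_sum differentiable_scaleR) auto
  then show ?thesis by (simp add: euclidean_representation)
qed

lemma ck_on_imp_differentiable: "ck_on (Suc k) S f \<Longrightarrow> x \<in> S \<Longrightarrow> f differentiable (at x)"
  by simp

lemma ck_on_cong:
  assumes "open S" "\<And>x. x \<in> S \<Longrightarrow> f x = g x"
  shows "ck_on k S f \<longleftrightarrow> ck_on k S g"
  using assms(2)
proof (induction k arbitrary: f g)
  case 0
  then show ?case by (auto intro: continuous_on_cong)
next
  case (Suc k)
  have "f differentiable (at x) \<longleftrightarrow> g differentiable (at x)" if "x \<in> S" for x
    using differentiable_cong[OF assms(1) that] Suc.prems by metis
  moreover have "ck_on k S (\<lambda>x. fd f x v) \<longleftrightarrow> ck_on k S (\<lambda>x. fd g x v)" for v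
    by (rule Suc.IH) (use fd_cong[OF assms(1)] Suc.prems in metis)
  ultimately show ?case by auto
qed

lemma ck_on_SucD: "ck_on (Suc k) S f \<Longrightarrow> ck_on k S f"
proof (induction k arbitrary: f)
  case 0
  then show ?case
    by (auto intro!: continuous_at_imp_continuous_on differentiable_imp_continuous_within)
next
  case (Suc k)
  show ?case
    unfolding ck_on.simps(2)[of k]
  proof safe
    fix v
    have "ck_on (Suc k) S (\<lambda>x. fd f x v)" using Suc.prems unfolding ck_on.simps(2)[of "Suc k"] by blast
    then show "ck_on k S (\<lambda>x. fd f x v)" by (rule Suc.IH)
  qed (use Suc.prems in simp)
qed

lemma ck_on_subset: "ck_on k S f \<Longrightarrow> T \<subseteq> S \<Longrightarrow> ck_on k T f"
  by (induction k arbitrary: f) (auto intro: continuous_on_subset)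

lemma ck_on_imp_continuous_on: "ck_on k S f \<Longrightarrow> continuous_on S f"
  by (induction k) (auto dest: ck_on_SucD simp del: ck_on.simps(2))

lemma ck_on_const [simp]: "ck_on k S (\<lambda>_. c)"
  by (induction k arbitrary: c) auto

lemma ck_on_add:
  assumes "open S" "ck_on k S f" "ck_on k S g"
  shows "ck_on k S (\<lambda>x. f x + g x)"
  using assms(2,3)
proof (induction k arbitrary: f g)
  case (Suc k)
  have "ck_on k S (\<lambda>x. fd (\<lambda>y. f y + g y) x v)" for v
    using Suc by (subst ck_on_cong[OF assms(1) fd_add]) auto
  with Suc show ?case by simp
qed (auto intro: continuous_on_add)

text \<open>Leibniz: the derivative is a sum of two products of the same kind, so the induction
  varies both factors; the undifferentiated factor is used with one order less than it has.\<close>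

lemma ck_on_bilinear:
  assumes "open S" "bounded_bilinear pr" "ck_on k S f" "ck_on k S g"
  shows "ck_on k S (\<lambda>x. pr (f x) (g x))"
  using assms(3,4)
proof (induction k arbitrary: f g)
  case 0
  then show ?case using bounded_bilinear.continuous_on[OF assms(2)] by auto
next
  case (Suc k)
  have "ck_on k S (\<lambda>x. fd (\<lambda>y. pr (f y) (g y)) x v)" for v
  proof (subst ck_on_cong[OF assms(1) fd_bilinear(1)[OF assms(2)]])
    have "ck_on k S f" "ck_on k S g"
      using ck_on_SucD Suc.prems by blast+
    then show "ck_on k S (\<lambda>x. pr (f x) (fd g x v) + pr (fd f x v) (g x))"
      using Suc by (intro ck_on_add[OF assms(1)] Suc.IH) auto
  qed (use Suc.prems in auto)
  moreover have "(\<lambda>y. pr (f y) (g y)) differentiable (at x)" if "x \<in> S" for x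
    by (rule fd_bilinear(2)[OF assms(2)]) (use Suc.prems that in auto)
  ultimately show ?case by simp
qed

lemma ck_on_bounded_linear:
  assumes "open S" "bounded_linear L" "ck_on k S f"
  shows "ck_on k S (\<lambda>x. L (f x))"
  using assms(3)
proof (induction k arbitrary: f)
  case 0
  then show ?case using bounded_linear.continuous_on[OF assms(2)] by auto
next
  case (Suc k)
  have "ck_on k S (\<lambda>x. fd (\<lambda>y. L (f y)) x v)" for v
    using Suc by (subst ck_on_cong[OF assms(1) fd_bounded_linear(1)[OF assms(2)]]) auto
  moreover have "(\<lambda>y. L (f y)) differentiable (at x)" if "x \<in> S" for x
    by (rule fd_bounded_linear(2)[OF assms(2)]) (use Suc.prems that in auto)
  ultimately show ?case by simp
qed

lemmas ck_on_scaleR = ck_on_bilinear[OF _ bounded_bilinear_scaleR]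
lemmas ck_on_mult = ck_on_bilinear[OF _ bounded_bilinear_mult]
lemmas ck_on_inner = ck_on_bounded_linear[OF _ bounded_linear_inner_left]

lemma ck_on_diff:
  assumes "open S" "ck_on k S f" "ck_on k S g"
  shows "ck_on k S (\<lambda>x. f x - g x)"
proof -
  have "ck_on k S (\<lambda>x. - g x)"
    by (rule ck_on_bounded_linear[OF assms(1) _ assms(3)]) (rule bounded_linear_minus[OF bounded_linear_ident])
  from ck_on_add[OF assms(1,2) this] show ?thesis by simp
qed

lemma ck_on_sum:
  assumes "open S" "\<And>i. i \<in> I \<Longrightarrow> ck_on k S (f i)"
  shows "ck_on k S (\<lambda>x. \<Sum>i\<in>I. f i x)"
  using assms(2) by (induction I rule: infinite_finite_induct) (auto intro: ck_on_add[OF assms(1)])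

text \<open>Families of linear maps are handled through their values on constant vectors; expanding the
  argument in a basis turns the application to a vector field into a finite sum of products.\<close>

lemma linear_basis_expansion:
  fixes v :: "'a::euclidean_space"
  assumes "linear L"
  shows "L v = (\<Sum>b\<in>Basis. (v \<bullet> b) *\<^sub>R L b)"
  by (subst euclidean_representation[symmetric, of v])
    (simp only: linear_sum[OF assms] linear_scale[OF assms])

lemma ck_on_family:
  fixes Y :: "'a::euclidean_space \<Rightarrow> 'c::euclidean_space"
  assumes "open S" "\<And>y. y \<in> S \<Longrightarrow> linear (M y)" "\<And>b. ck_on k S (\<lambda>y. M y b)" "ck_on k S Y"
  shows "ck_on k S (\<lambda>y. M y (Y y))"
proof (subst ck_on_cong[OF assms(1) linear_basis_expansion[OF assms(2)]])
  show "ck_on k S (\<lambda>y. \<Sum>b\<in>Basis. (Y y \<bullet> b) *\<^sub>R M y b)"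
    using assms by (intro ck_on_sum ck_on_scaleR ck_on_inner) auto
qed

lemma fd_family:
  fixes Y :: "'a::euclidean_space \<Rightarrow> 'c::euclidean_space"
  assumes "open S" "x \<in> S" "\<And>y. y \<in> S \<Longrightarrow> linear (M y)"
    and M: "\<And>b. (\<lambda>y. M y b) differentiable (at x)" and Y: "Y differentiable (at x)"
  shows "fd (\<lambda>y. M y (Y y)) x v = fd (\<lambda>y. M y (Y x)) x v + M x (fd Y x v)"
    and "(\<lambda>y. M y (Y y)) differentiable (at x)"
proof -
  have eq: "fd (\<lambda>y. M y (Z y)) x v
      = (\<Sum>b\<in>Basis. (Z x \<bullet> b) *\<^sub>R fd (\<lambda>y. M y b) x v + (fd Z x v \<bullet> b) *\<^sub>R M x b)"
    if Z: "Z differentiable (at x)" for Z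
  proof -
    have "fd (\<lambda>y. M y (Z y)) x v = fd (\<lambda>y. \<Sum>b\<in>Basis. (Z y \<bullet> b) *\<^sub>R M y b) x v"
      by (subst fd_cong[OF assms(1,2) linear_basis_expansion[OF assms(3)]]) auto
    also have "\<dots> = (\<Sum>b\<in>Basis. fd (\<lambda>y. (Z y \<bullet> b) *\<^sub>R M y b) x v)"
      by (rule fd_sum) (use M Z in \<open>auto intro!: differentiable_scaleR fd_inner(2)\<close>)
    also have "\<dots> = (\<Sum>b\<in>Basis. (Z x \<bullet> b) *\<^sub>R fd (\<lambda>y. M y b) x v + (fd Z x v \<bullet> b) *\<^sub>R M x b)"
      by (rule sum.cong) (use M Z in \<open>auto simp: fd_scaleR fd_inner\<close>)
    finally show ?thesis .
  qed
  have "fd (\<lambda>y. M y (Y x)) x v = (\<Sum>b\<in>Basis. (Y x \<bullet> b) *\<^sub>R fd (\<lambda>y. M y b) x v)"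
    by (subst eq[of "\<lambda>_. Y x"]) auto
  moreover have "M x (fd Y x v) = (\<Sum>b\<in>Basis. (fd Y x v \<bullet> b) *\<^sub>R M x b)"
    using linear_basis_expansion[OF assms(3)[OF assms(2)]] .
  ultimately show "fd (\<lambda>y. M y (Y y)) x v = fd (\<lambda>y. M y (Y x)) x v + M x (fd Y x v)"
    by (simp add: eq[OF Y] sum.distrib)
  have "(\<lambda>y. \<Sum>b\<in>Basis. (Y y \<bullet> b) *\<^sub>R M y b) differentiable (at x)"
    by (intro differentiable_sum ballI differentiable_scaleR fd_inner(2) M Y finite_Basis)
  then show "(\<lambda>y. M y (Y y)) differentiable (at x)"
    by (rule differentiable_cong[OF assms(1,2) linear_basis_expansion[OF assms(3)], rotated])
qed

text \<open>The one-argument rule twice: the family \<open>M y (Y y)\<close> is evaluated on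
  \<open>Z\<close>, then, with the last argument frozen at \<open>Z x\<close>, the family is
  evaluated on \<open>Y\<close>. It serves metrics and Christoffel maps.\<close>

lemma fd_family2:
  fixes Y :: "'a::euclidean_space \<Rightarrow> 'c::euclidean_space" and Z :: "'a \<Rightarrow> 'd::euclidean_space"
  assumes "open S" "x \<in> S" "\<And>y z. y \<in> S \<Longrightarrow> linear (\<lambda>a. M y a z)" "\<And>y a. y \<in> S \<Longrightarrow> linear (M y a)"
    and M: "\<And>a b. (\<lambda>y. M y a b) differentiable (at x)" and Y: "Y differentiable (at x)"
    and Z: "Z differentiable (at x)"
  shows "fd (\<lambda>y. M y (Y y) (Z y)) x v
      = fd (\<lambda>y. M y (Y x) (Z x)) x v + M x (fd Y x v) (Z x) + M x (Y x) (fd Z x v)"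
    and "(\<lambda>y. M y (Y y) (Z y)) differentiable (at x)"
proof -
  have d: "(\<lambda>y. M y (Y y) b) differentiable (at x)" for b
    by (rule fd_family(2)[where M="\<lambda>y a. M y a b", OF assms(1,2,3)]) (use M Y in auto)
  show "fd (\<lambda>y. M y (Y y) (Z y)) x v
      = fd (\<lambda>y. M y (Y x) (Z x)) x v + M x (fd Y x v) (Z x) + M x (Y x) (fd Z x v)"
    by (subst fd_family(1)[where M="\<lambda>y. M y (Y y)", OF assms(1,2,4)], assumption, rule d, rule Z,
        subst fd_family(1)[where M="\<lambda>y a. M y a (Z x)", OF assms(1,2,3)])
      (use M Y in auto)
  show "(\<lambda>y. M y (Y y) (Z y)) differentiable (at x)"
    by (rule fd_family(2)[where M="\<lambda>y. M y (Y y)", OF assms(1,2,4)]) (use d Z in auto)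
qed

lemma ck_on_family2:
  fixes Y :: "'a::euclidean_space \<Rightarrow> 'c::euclidean_space" and Z :: "'a \<Rightarrow> 'd::euclidean_space"
  assumes "open S" "\<And>y z. y \<in> S \<Longrightarrow> linear (\<lambda>a. M y a z)" "\<And>y a. y \<in> S \<Longrightarrow> linear (M y a)"
    and "\<And>a b. ck_on k S (\<lambda>y. M y a b)" "ck_on k S Y" "ck_on k S Z"
  shows "ck_on k S (\<lambda>y. M y (Y y) (Z y))"
  by (rule ck_on_family[where M="\<lambda>y. M y (Y y)", OF assms(1,3)], assumption,
      rule ck_on_family[where M="\<lambda>y a. M y a b" for b, OF assms(1,2)]) (use assms in auto)

text \<open>By the chain rule the derivative is the family of linear maps \<open>fd f (g x)\<close>
  evaluated on the field \<open>fd g x v\<close>. The induction varies only \<open>f\<close>: the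
  values of the family are derivatives of \<open>f\<close> in a constant direction, composed with
  the same \<open>g\<close>.\<close>

lemma ck_on_compose:
  fixes f :: "'b::euclidean_space \<Rightarrow> 'c::real_normed_vector" and g :: "'a::euclidean_space \<Rightarrow> 'b"
  assumes "open S" "ck_on k S g" "ck_on k T f" "g ` S \<subseteq> T"
  shows "ck_on k S (\<lambda>x. f (g x))"
  using assms(2,3)
proof (induction k arbitrary: f)
  case 0
  then show ?case using assms(4) by (auto intro: continuous_on_compose2)
next
  case (Suc k)
  have T: "g x \<in> T" if "x \<in> S" for x using assms(4) that by auto
  have d: "g differentiable (at x)" "f differentiable (at (g x))" if "x \<in> S" for x
    using Suc.prems T[OF that] that by auto
  have "ck_on k S (\<lambda>x. fd (\<lambda>y. f (g y)) x v)" for v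
  proof (subst ck_on_cong[OF assms(1) fd_compose(1)[OF d]])
    show "ck_on k S (\<lambda>x. fd f (g x) (fd g x v))"
    proof (rule ck_on_family[OF assms(1)])
      show "linear (fd f (g y))" if "y \<in> S" for y using d[OF that] linear_fd by blast
      show "ck_on k S (\<lambda>y. fd f (g y) b)" for b
        by (rule Suc.IH) (use Suc.prems ck_on_SucD in auto)
      show "ck_on k S (\<lambda>x. fd g x v)" using Suc.prems by simp
    qed
  qed auto
  moreover have "(\<lambda>x. f (g x)) differentiable (at x)" if "x \<in> S" for x
    using fd_compose(2)[OF d[OF that]] .
  ultimately show ?case by simp
qed

lemma ck_on_exp: "ck_on k UNIV (exp :: real \<Rightarrow> real)"
proof (induction k)
  case (Suc k)
  have e: "fd exp x v = exp x * v" for x v :: real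
    by (rule fd_eqI) (auto intro!: derivative_eq_intros)
  have "ck_on k UNIV (\<lambda>x. exp x * v)" for v :: real
    by (rule ck_on_mult) (use Suc in auto)
  moreover have "exp differentiable (at x)" for x :: real
    using DERIV_exp real_differentiable_def field_differentiable_def
      field_differentiable_imp_differentiable by blast
  ultimately show ?case by (simp add: e)
qed (auto intro: continuous_intros)

text \<open>Both mixed derivatives are limits of the same second difference quotient.\<close>

lemma fd_symmetric_real:
  fixes f :: "'a::euclidean_space \<Rightarrow> real"
  assumes "open S" "x \<in> S" "ck_on (Suc (Suc 0)) S f"
  shows "fd (\<lambda>y. fd f y u) x v = fd (\<lambda>y. fd f y v) x u"
proof -
  define D2 where "D2 y u v = fd (\<lambda>y. fd f y u) y v" for y u v
  define \<Delta> where "\<Delta> s u v = f (x + s *\<^sub>R u + s *\<^sub>R v) - f (x + s *\<^sub>R u) - f (x + s *\<^sub>R v) + f x" for s u v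
  have key: "((\<lambda>s. \<Delta> s u v / s\<^sup>2) \<longlongrightarrow> D2 x u v) (at_right 0)" for u v
  proof (rule tendstoI)
    fix e :: real assume "e > 0"
    have "continuous_on S (\<lambda>y. D2 y u v)"
      using assms(3) by (simp add: D2_def)
    then have "isCont (\<lambda>y. D2 y u v) x" using assms(1,2) by (simp add: continuous_on_eq_continuous_at)
    then obtain d0 where d0: "d0 > 0" "\<And>y. dist y x < d0 \<Longrightarrow> dist (D2 y u v) (D2 x u v) < e"
      using \<open>e > 0\<close> unfolding continuous_at_eps_delta by metis
    obtain d1 where d1: "d1 > 0" "ball x d1 \<subseteq> S" using assms(1,2) openE by blast
    \<comment> \<open>Chosen so that x + a u + b v stays in both balls for 0 \<le> a, b < d; the
      summand 1 covers u = v = 0.\<close>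
    define d where "d = min d0 d1 / (norm u + norm v + 1)"
    have nn: "norm u + norm v + 1 > 0" by (smt (verit) norm_ge_zero)
    have "d > 0" using d0 d1 nn by (simp add: d_def)
    have small: "dist (x + a *\<^sub>R u + b *\<^sub>R v) x < min d0 d1"
      if "0 \<le> a" "a < d" "0 \<le> b" "b < d" for a b
    proof -
      have "dist (x + a *\<^sub>R u + b *\<^sub>R v) x = norm (a *\<^sub>R u + b *\<^sub>R v)"
        by (simp add: dist_norm add.assoc)
      also have "\<dots> \<le> norm (a *\<^sub>R u) + norm (b *\<^sub>R v)" by (rule norm_triangle_ineq)
      also have "\<dots> \<le> d * norm u + d * norm v" using that by (auto intro!: add_mono mult_right_mono)
      also have "\<dots> < d * (norm u + norm v + 1)" using \<open>d > 0\<close> by (simp add: algebra_simps)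
      also have "\<dots> = min d0 d1" using nn by (simp add: d_def)
      finally show ?thesis .
    qed
    have inS: "x + a *\<^sub>R u + b *\<^sub>R v \<in> S" if "0 \<le> a" "a < d" "0 \<le> b" "b < d" for a b
      using small[OF that] d1 by (auto simp: dist_commute subset_eq)
    have "dist (\<Delta> s u v / s\<^sup>2) (D2 x u v) < e" if s: "0 < s" "s < d" for s
    proof -
      have df: "f differentiable (at y)" "(\<lambda>y. fd f y u) differentiable (at y)" if "y \<in> S" for y
        using assms(3) that by auto
      have der1: "((\<lambda>t. f (x + t *\<^sub>R u + b *\<^sub>R v)) has_derivative (\<lambda>h. fd f (x + t *\<^sub>R u + b *\<^sub>R v) (h *\<^sub>R u))) (at t)"
        if "0 \<le> t" "t < d" "0 \<le> b" "b < d" for t b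
      proof (rule has_derivative_compose[where f="\<lambda>t. x + t *\<^sub>R u + b *\<^sub>R v"])
        show "((\<lambda>t. x + t *\<^sub>R u + b *\<^sub>R v) has_derivative (\<lambda>h. h *\<^sub>R u)) (at t)"
          by (auto intro!: derivative_eq_intros)
      qed (rule has_derivative_fd[OF df(1)[OF inS[OF that]]])
      \<comment> \<open>The mean value theorem for t \<mapsto> f (x + t u + s v) - f (x + t u) turns
        the second difference into a first difference of the u-derivative, to which it is applied
        again in direction v. The summand \<open>0 *\<^sub>R v\<close> keeps both points in the
        shape covered by \<open>inS\<close>.\<close>
      have "\<exists>\<theta>\<in>{0<..<s}. \<Delta> s u v = (\<lambda>h. fd f (x + \<theta> *\<^sub>R u + s *\<^sub>R v) (h *\<^sub>R u)
             - fd f (x + \<theta> *\<^sub>R u + 0 *\<^sub>R v) (h *\<^sub>R u)) (s - 0)"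
      proof -
        have "\<exists>\<theta>\<in>{0<..<s}. (\<lambda>t. f (x + t *\<^sub>R u + s *\<^sub>R v) - f (x + t *\<^sub>R u + 0 *\<^sub>R v)) s
            - (\<lambda>t. f (x + t *\<^sub>R u + s *\<^sub>R v) - f (x + t *\<^sub>R u + 0 *\<^sub>R v)) 0
            = (\<lambda>h. fd f (x + \<theta> *\<^sub>R u + s *\<^sub>R v) (h *\<^sub>R u)
             - fd f (x + \<theta> *\<^sub>R u + 0 *\<^sub>R v) (h *\<^sub>R u)) (s - 0)"
          by (rule mvt_simple[OF s(1)])
            (use s in \<open>auto intro!: has_derivative_at_withinI[OF has_derivative_diff] der1 der1[of _ 0, simplified]\<close>)
        then show ?thesis by (simp add: \<Delta>_def algebra_simps)
      qed
      then obtain \<theta> where \<theta>: "0 < \<theta>" "\<theta> < s"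
        "\<Delta> s u v = fd f (x + \<theta> *\<^sub>R u + s *\<^sub>R v) (s *\<^sub>R u) - fd f (x + \<theta> *\<^sub>R u + 0 *\<^sub>R v) (s *\<^sub>R u)"
        by auto
      have lin: "fd f (x + \<theta> *\<^sub>R u + b *\<^sub>R v) (s *\<^sub>R u) = s * fd f (x + \<theta> *\<^sub>R u + b *\<^sub>R v) u"
        if "0 \<le> b" "b < d" for b
        using linear_scale[OF linear_fd[OF df(1)[OF inS[of \<theta> b]]]] \<theta> s that by simp
      have der2: "((\<lambda>t. fd f (x + \<theta> *\<^sub>R u + t *\<^sub>R v) u) has_derivative
          (\<lambda>h. fd (\<lambda>y. fd f y u) (x + \<theta> *\<^sub>R u + t *\<^sub>R v) (h *\<^sub>R v))) (at t)"
        if "0 \<le> t" "t < d" for t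
      proof (rule has_derivative_compose[where f="\<lambda>t. x + \<theta> *\<^sub>R u + t *\<^sub>R v"])
        show "((\<lambda>t. x + \<theta> *\<^sub>R u + t *\<^sub>R v) has_derivative (\<lambda>h. h *\<^sub>R v)) (at t)"
          by (auto intro!: derivative_eq_intros)
      qed (use \<theta> s that in \<open>auto intro!: has_derivative_fd df inS\<close>)
      have "\<exists>\<eta>\<in>{0<..<s}. fd f (x + \<theta> *\<^sub>R u + s *\<^sub>R v) u - fd f (x + \<theta> *\<^sub>R u + 0 *\<^sub>R v) u
          = (\<lambda>h. fd (\<lambda>y. fd f y u) (x + \<theta> *\<^sub>R u + \<eta> *\<^sub>R v) (h *\<^sub>R v)) (s - 0)"
        by (rule mvt_simple[OF s(1), where f="\<lambda>t. fd f (x + \<theta> *\<^sub>R u + t *\<^sub>R v) u"])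
          (use s in \<open>auto intro!: has_derivative_at_withinI[OF der2]\<close>)
      then obtain \<eta> where \<eta>: "0 < \<eta>" "\<eta> < s" 
        "fd f (x + \<theta> *\<^sub>R u + s *\<^sub>R v) u - fd f (x + \<theta> *\<^sub>R u + 0 *\<^sub>R v) u
          = fd (\<lambda>y. fd f y u) (x + \<theta> *\<^sub>R u + \<eta> *\<^sub>R v) (s *\<^sub>R v)" by auto
      have "fd (\<lambda>y. fd f y u) (x + \<theta> *\<^sub>R u + \<eta> *\<^sub>R v) (s *\<^sub>R v) = s * D2 (x + \<theta> *\<^sub>R u + \<eta> *\<^sub>R v) u v"
        using linear_scale[OF linear_fd[OF df(2)[OF inS[of \<theta> \<eta>]]]] \<theta> \<eta> s by (simp add: D2_def)
      then have "\<Delta> s u v = s * (s * D2 (x + \<theta> *\<^sub>R u + \<eta> *\<^sub>R v) u v)"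
        using \<theta> \<eta> s lin[of s] lin[of 0] by (simp add: right_diff_distrib[symmetric])
      then have "\<Delta> s u v / s\<^sup>2 = D2 (x + \<theta> *\<^sub>R u + \<eta> *\<^sub>R v) u v"
        using s by (simp add: power2_eq_square)
      then show ?thesis using d0(2) small[of \<theta> \<eta>] \<theta> \<eta> s by simp
    qed
    then show "\<forall>\<^sub>F s in at_right 0. dist (\<Delta> s u v / s\<^sup>2) (D2 x u v) < e"
      using \<open>d > 0\<close> unfolding eventually_at_right_field by blast
  qed
  have "\<Delta> s u v = \<Delta> s v u" for s by (simp add: \<Delta>_def algebra_simps)
  then have "((\<lambda>s. \<Delta> s u v / s\<^sup>2) \<longlongrightarrow> D2 x v u) (at_right 0)"
    using key[of v u] by simp
  then have "D2 x u v = D2 x v u"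
    using key[of u v] tendsto_unique trivial_limit_at_right_real by blast
  then show ?thesis by (simp add: D2_def)
qed

lemma fd_symmetric:
  fixes f :: "'a::euclidean_space \<Rightarrow> 'b::euclidean_space"
  assumes "open S" "x \<in> S" "ck_on (Suc (Suc 0)) S f"
  shows "fd (\<lambda>y. fd f y u) x v = fd (\<lambda>y. fd f y v) x u"
proof (rule euclidean_eqI)
  fix b :: 'b assume "b \<in> Basis"
  have d: "f differentiable (at y)" "(\<lambda>y. fd f y u) differentiable (at y)" if "y \<in> S" for y u
    using assms(3) that by auto
  have "fd (\<lambda>y. fd f y u) x v \<bullet> b = fd (\<lambda>y. fd (\<lambda>z. f z \<bullet> b) y u) x v" for u v
    using fd_cong[OF assms(1,2), where f="\<lambda>y. fd (\<lambda>z. f z \<bullet> b) y u" and g="\<lambda>y. fd f y u \<bullet> b"]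
      fd_inner(1)[OF d(1)] fd_inner(1)[OF d(2)[OF assms(2)]] by simp
  then show "fd (\<lambda>y. fd f y u) x v \<bullet> b = fd (\<lambda>y. fd f y v) x u \<bullet> b"
    using fd_symmetric_real[OF assms(1,2) ck_on_inner[OF assms(1,3)]] by simp
qed

section \<open>Smooth families of inner products\<close>

lemma ck_on_fd: "ck_on (Suc k) S f \<Longrightarrow> ck_on k S (\<lambda>x. fd f x v)"
  by simp

lemma ck_on_0_isCont: "ck_on 0 S f \<Longrightarrow> open S \<Longrightarrow> x \<in> S \<Longrightarrow> isCont f x"
  by (simp add: continuous_on_eq_continuous_at)

lemma smooth_on_imp_differentiable: "smooth_on S f \<Longrightarrow> x \<in> S \<Longrightarrow> f differentiable (at x)"
  unfolding smooth_on_def by (rule ck_on_imp_differentiable) (erule spec)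

lemma smooth_on_fd: "smooth_on S f \<Longrightarrow> smooth_on S (\<lambda>x. fd f x v)"
  unfolding smooth_on_def by (metis ck_on.simps(2))

lemma smooth_on_cong:
  "open S \<Longrightarrow> (\<And>x. x \<in> S \<Longrightarrow> f x = g x) \<Longrightarrow> smooth_on S f \<longleftrightarrow> smooth_on S g"
  unfolding smooth_on_def using ck_on_cong by blast

lemma smooth_on_const [simp]: "smooth_on S (\<lambda>_. c)"
  by (simp add: smooth_on_def)

lemma inner_product_onD:
  assumes "inner_product_on Q b" "u \<in> Q" "v \<in> Q"
  shows "b u v = b v u" "w \<in> Q \<Longrightarrow> b (u + v) w = b u w + b v w" "b (r *\<^sub>R u) v = r * b u v"
    "u \<noteq> 0 \<Longrightarrow> 0 < b u u"
  using assms unfolding inner_product_on_def by simp_all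

lemma inner_product_linear:
  assumes "inner_product_on UNIV b"
  shows "linear (\<lambda>u. b u v)" "linear (b u)"
proof -
  show l: "linear (\<lambda>u. b u v)" for v
    by (rule linearI) (simp_all add: inner_product_onD(2,3)[OF assms])
  have "(\<lambda>v. b v u) = b u"
    by (rule ext) (rule inner_product_onD(1)[OF assms UNIV_I UNIV_I])
  then show "linear (b u)" using l[of u] by simp
qed

lemma inner_product_eqI:
  assumes "inner_product_on UNIV b" "\<And>z. b u z = b v z"
  shows "u = v"
proof -
  have "b (u - v) (u - v) = 0"
    using linear_diff[OF inner_product_linear(1)[OF assms(1)]] assms(2) by simp
  then show ?thesis using inner_product_onD(4)[OF assms(1), of "u - v"] by fastforce
qed

text \<open>The map \<open>T\<close> takes w to the coordinates of the functional
  \<open>b w\<close>. Definiteness makes it injective, hence surjective in finite dimension. This is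
  the existence half behind the definite descriptions below.\<close>

lemma riesz:
  fixes b :: "'a::euclidean_space \<Rightarrow> 'a \<Rightarrow> real"
  assumes "inner_product_on UNIV b" "linear \<kappa>"
  shows "\<exists>w. \<forall>z. b w z = \<kappa> z"
proof -
  define T where "T w = (\<Sum>i\<in>Basis. b w i *\<^sub>R i)" for w
  have Ti: "T w \<bullet> i = b w i" if "i \<in> Basis" for w i
    using that by (simp add: T_def inner_sum_left inner_Basis if_distrib cong: if_cong)
  note lin = inner_product_linear[OF assms(1)]
  have "linear T"
    unfolding T_def
    by (rule linearI) (simp_all add: linear_add[OF lin(1)] linear_scale[OF lin(1)] scaleR_left_distrib
        sum.distrib scaleR_sum_right)
  moreover have "inj T"
  proof (rule injI)
    fix u v assume "T u = T v"
    then have "b u i = b v i" if "i \<in> Basis" for i using Ti that by metis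
    then have "b u z = b v z" for z
      using linear_basis_expansion[OF lin(2), of u z] linear_basis_expansion[OF lin(2), of v z] by simp
    then show "u = v" by (rule inner_product_eqI[OF assms(1)])
  qed
  ultimately have "surj T" using linear_inj_imp_surj by blast
  then obtain w where w: "T w = (\<Sum>i\<in>Basis. \<kappa> i *\<^sub>R i)" by (metis surjD)
  have "b w i = \<kappa> i" if "i \<in> Basis" for i
    using Ti[OF that, of w] that by (simp add: w inner_sum_left inner_Basis if_distrib cong: if_cong)
  then have "b w z = \<kappa> z" for z
    using linear_basis_expansion[OF lin(2), of w z] linear_basis_expansion[OF assms(2), of z] by simp
  then show ?thesis by blast
qed

section \<open>Regularity of solutions of linear equations that depend on a parameter\<close>

lemma inner_product_coercive:
  fixes b :: "'a::euclidean_space \<Rightarrow> 'a \<Rightarrow> real"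
  assumes "inner_product_on UNIV b"
  obtains c where "c > 0" "\<And>v. c * (norm v)\<^sup>2 \<le> b v v"
proof -
  note lin = inner_product_linear[OF assms]
  have "bounded_bilinear b"
    using lin by (simp add: bilinear_conv_bounded_bilinear[symmetric] bilinear_def)
  then have "continuous_on (sphere 0 1) (\<lambda>v. b v v)"
    by (rule bounded_bilinear.continuous_on) auto
  moreover have "sphere (0::'a) 1 \<noteq> {}" by simp
  ultimately obtain e where e: "norm e = 1" "\<And>v. norm v = 1 \<Longrightarrow> b e e \<le> b v v"
    using continuous_attains_inf[of "sphere 0 1" "\<lambda>v. b v v"] by auto
  have "b e e * (norm v)\<^sup>2 \<le> b v v" for v
  proof (cases "v = 0")
    case False
    define u where "u = v /\<^sub>R norm v"
    have "norm u = 1" and v: "norm v *\<^sub>R u = v" using False by (auto simp: u_def)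
    have "b (norm v *\<^sub>R u) (norm v *\<^sub>R u) = (norm v)\<^sup>2 * b u u"
      by (simp add: power2_eq_square linear_scale[OF lin(1)] linear_scale[OF lin(2)])
    then show ?thesis using e(2)[OF \<open>norm u = 1\<close>] by (simp add: v mult.commute mult_right_mono)
  qed (use linear_0[OF lin(1)] in simp)
  moreover have "b e e > 0" using inner_product_onD(4)[OF assms, of e] e(1) by (cases "e = 0") auto
  ultimately show ?thesis using that by blast
qed

text \<open>The constant is a sum over matrix entries, so it tends to 0 with them: applied to
  \<open>G y - G x\<close>, it turns entrywise continuity of a metric into an estimate uniform in
  the vectors.\<close>

lemma bilinear_bound:
  fixes b :: "'a::euclidean_space \<Rightarrow> 'a \<Rightarrow> real"
  assumes "\<And>z. linear (\<lambda>a. b a z)" "\<And>a. linear (b a)"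
  shows "\<bar>b u v\<bar> \<le> (\<Sum>i\<in>Basis. \<Sum>j\<in>Basis. \<bar>b i j\<bar>) * norm u * norm v"
proof -
  have "b u v = (\<Sum>i\<in>Basis. \<Sum>j\<in>Basis. (u \<bullet> i) * (v \<bullet> j) * b i j)"
    by (subst linear_basis_expansion[OF assms(1)], subst linear_basis_expansion[OF assms(2)])
      (simp add: sum_distrib_left mult.assoc)
  also have "\<bar>\<dots>\<bar> \<le> (\<Sum>i\<in>Basis. \<Sum>j\<in>Basis. \<bar>(u \<bullet> i) * (v \<bullet> j) * b i j\<bar>)"
    by (rule order_trans[OF sum_abs sum_mono[OF sum_abs]])
  also have "\<dots> \<le> (\<Sum>i\<in>Basis. \<Sum>j\<in>Basis. norm u * norm v * \<bar>b i j\<bar>)"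
    by (intro sum_mono) (auto simp: abs_mult intro!: mult_right_mono mult_mono Basis_le_norm)
  also have "\<dots> = (\<Sum>i\<in>Basis. \<Sum>j\<in>Basis. \<bar>b i j\<bar>) * norm u * norm v"
    by (simp add: sum_distrib_left sum_distrib_right mult_ac)
  finally show ?thesis .
qed

lemma linear_bound:
  fixes \<kappa> :: "'a::euclidean_space \<Rightarrow> real"
  assumes "linear \<kappa>"
  shows "\<bar>\<kappa> v\<bar> \<le> (\<Sum>i\<in>Basis. \<bar>\<kappa> i\<bar>) * norm v"
proof -
  have "\<kappa> v = (\<Sum>i\<in>Basis. (v \<bullet> i) * \<kappa> i)"
    using linear_basis_expansion[OF assms, of v] by simp
  also have "\<bar>\<dots>\<bar> \<le> (\<Sum>i\<in>Basis. \<bar>(v \<bullet> i) * \<kappa> i\<bar>)" by (rule sum_abs)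
  also have "\<dots> \<le> (\<Sum>i\<in>Basis. norm v * \<bar>\<kappa> i\<bar>)"
    by (intro sum_mono) (auto simp: abs_mult intro!: mult_right_mono Basis_le_norm)
  finally show ?thesis by (simp add: sum_distrib_left mult.commute)
qed

lemma linear_fd_family:
  assumes "open S" "x \<in> S" "\<And>y. y \<in> S \<Longrightarrow> linear (M y)" "\<And>b. (\<lambda>y. M y b) differentiable (at x)"
  shows "linear (\<lambda>b. fd (\<lambda>y. M y b) x v)"
proof (rule linearI)
  fix a b r
  have "fd (\<lambda>y. M y (a + b)) x v = fd (\<lambda>y. M y a + M y b) x v"
    by (subst fd_cong[OF assms(1,2) linear_add[OF assms(3)]]) auto
  then show "fd (\<lambda>y. M y (a + b)) x v = fd (\<lambda>y. M y a) x v + fd (\<lambda>y. M y b) x v"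
    by (simp add: fd_add[OF assms(4,4)])
  have "fd (\<lambda>y. M y (r *\<^sub>R a)) x v = fd (\<lambda>y. r *\<^sub>R M y a) x v"
    by (subst fd_cong[OF assms(1,2) linear_scale[OF assms(3)]]) auto
  then show "fd (\<lambda>y. M y (r *\<^sub>R a)) x v = r *\<^sub>R fd (\<lambda>y. M y a) x v"
    by (simp add: fd_bounded_linear(1)[OF bounded_linear_scaleR_right assms(4)])
qed

text \<open>The error term is g (x + h) times the error of f plus g (x + h) - g x times the
  derivative of f, both o(h). This breaks a circle below, where a solution is known to be continuous
  before it is known to be differentiable.\<close>

lemma differentiable_continuous_mult_zero:
  fixes f g :: "'a::real_normed_vector \<Rightarrow> real"
  assumes "f differentiable (at x)" "f x = 0" "isCont g x"
  shows "(\<lambda>y. g y * f y) differentiable (at x)"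
proof -
  let ?D = "fd f x"
  have D: "(f has_derivative ?D) (at x)" by (rule has_derivative_fd[OF assms(1)])
  then interpret D: bounded_linear ?D by (rule has_derivative_bounded_linear)
  obtain K where K: "\<And>h. norm (?D h) \<le> norm h * K" using D.bounded by blast
  have lim: "((\<lambda>h. norm (f (x + h) - f x - ?D h) / norm h) \<longlongrightarrow> 0) (at 0)"
    using D unfolding has_derivative_at by blast
  have g: "((\<lambda>h. g (x + h)) \<longlongrightarrow> g x) (at 0)"
    using assms(3) by (simp add: isCont_iff)
  have "((\<lambda>h. \<bar>g (x + h)\<bar> * (norm (f (x + h) - f x - ?D h) / norm h) + \<bar>g (x + h) - g x\<bar> * K) \<longlongrightarrow>
      \<bar>g x\<bar> * 0 + \<bar>g x - g x\<bar> * K) (at 0)"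
    by (intro tendsto_intros lim g)
  then have "((\<lambda>h. norm (g (x + h) * f (x + h) - g x * f x - g x * ?D h) / norm h) \<longlongrightarrow> 0) (at 0)"
  proof (rule Lim_null_comparison[rotated, OF tendsto_eq_rhs])
    show "\<forall>\<^sub>F h in at 0. norm (norm (g (x + h) * f (x + h) - g x * f x - g x * ?D h) / norm h)
        \<le> \<bar>g (x + h)\<bar> * (norm (f (x + h) - f x - ?D h) / norm h) + \<bar>g (x + h) - g x\<bar> * K"
    proof (rule eventuallyI)
      fix h
      have "g (x + h) * f (x + h) - g x * f x - g x * ?D h
          = g (x + h) * (f (x + h) - f x - ?D h) + (g (x + h) - g x) * ?D h"
        by (simp add: assms(2) algebra_simps)
      then have "norm (g (x + h) * f (x + h) - g x * f x - g x * ?D h)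
          \<le> \<bar>g (x + h)\<bar> * norm (f (x + h) - f x - ?D h) + \<bar>g (x + h) - g x\<bar> * (norm h * K)"
        using mult_left_mono[OF K[of h], of "\<bar>g (x + h) - g x\<bar>"]
          abs_triangle_ineq[of "g (x + h) * (f (x + h) - f x - ?D h)" "(g (x + h) - g x) * ?D h"]
        by (simp add: abs_mult)
      then have "norm (g (x + h) * f (x + h) - g x * f x - g x * ?D h) / norm h
          \<le> (\<bar>g (x + h)\<bar> * norm (f (x + h) - f x - ?D h) + \<bar>g (x + h) - g x\<bar> * (norm h * K)) / norm h"
        by (rule divide_right_mono) simp
      also have "\<dots> \<le> \<bar>g (x + h)\<bar> * (norm (f (x + h) - f x - ?D h) / norm h) + \<bar>g (x + h) - g x\<bar> * K"
        by (cases "h = 0") (simp_all add: add_divide_distrib D.zero assms(2))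
      finally show "norm (norm (g (x + h) * f (x + h) - g x * f x - g x * ?D h) / norm h)
        \<le> \<bar>g (x + h)\<bar> * (norm (f (x + h) - f x - ?D h) / norm h) + \<bar>g (x + h) - g x\<bar> * K"
        by simp
    qed
  qed simp
  moreover have "bounded_linear (\<lambda>h. g x * ?D h)"
    by (rule bounded_linear_compose[OF bounded_linear_mult_right D.bounded_linear_axioms])
  ultimately show ?thesis unfolding has_derivative_at differentiable_def by blast
qed

text \<open>Put e = w y - w x. The equation at y bounds G y e e by the residual R y times the norm
  of e, and R vanishes at x. Near x, half of the coercivity constant of \<open>G x\<close> survives
  for \<open>G y\<close>, so the norm of e is at most 2 R y / c.\<close>

lemma continuous_solution:
  fixes G :: "'a::euclidean_space \<Rightarrow> 'b::euclidean_space \<Rightarrow> 'b \<Rightarrow> real"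
  assumes "open S" "x \<in> S" and G: "\<And>y. y \<in> S \<Longrightarrow> inner_product_on UNIV (G y)"
    and sol: "\<And>y z. y \<in> S \<Longrightarrow> G y (w y) z = \<kappa> y z"
    and cG: "\<And>a b. isCont (\<lambda>y. G y a b) x" and c\<kappa>: "\<And>z. isCont (\<lambda>y. \<kappa> y z) x"
  shows "isCont w x"
proof -
  obtain c where c: "c > 0" "\<And>v. c * (norm v)\<^sup>2 \<le> G x v v"
    using inner_product_coercive[OF G[OF assms(2)]] by blast
  define \<epsilon> where "\<epsilon> y = (\<Sum>i\<in>Basis. \<Sum>j\<in>Basis. \<bar>G y i j - G x i j\<bar>)" for y
  define R where "R y = (\<Sum>i\<in>Basis. \<bar>\<kappa> y i - G y (w x) i\<bar>)" for y
  have "isCont \<epsilon> x" unfolding \<epsilon>_def by (intro continuous_intros cG)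
  then have "(\<epsilon> \<longlongrightarrow> 0) (at x)" by (simp add: isCont_def \<epsilon>_def)
  then have "\<forall>\<^sub>F y in at x. \<epsilon> y < c / 2" using c(1) by (intro order_tendstoD) auto
  moreover have "\<forall>\<^sub>F y in at x. y \<in> S"
    using assms(1,2) by (simp add: eventually_at_topological) blast
  ultimately have "\<forall>\<^sub>F y in at x. norm (w y - w x) \<le> 2 * R y / c"
  proof eventually_elim
    case (elim y)
    note lin = inner_product_linear[OF G[OF elim(2)]] and linx = inner_product_linear[OF G[OF assms(2)]]
    let ?e = "w y - w x"
    have "\<bar>G y ?e ?e - G x ?e ?e\<bar> \<le> \<epsilon> y * norm ?e * norm ?e"
      unfolding \<epsilon>_def
      by (rule bilinear_bound[where b="\<lambda>u v. G y u v - G x u v"]) (intro linear_compose_sub lin linx)+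
    moreover have "\<epsilon> y * norm ?e * norm ?e \<le> c / 2 * norm ?e * norm ?e"
      using elim(1) by (intro mult_right_mono) auto
    moreover have "G y ?e z = \<kappa> y z - G y (w x) z" for z
      by (simp add: linear_diff[OF lin(1)] sol[OF elim(2)])
    then have "\<bar>G y ?e ?e\<bar> \<le> R y * norm ?e"
      using linear_bound[OF lin(2)[of ?e]] by (simp add: R_def)
    ultimately have "c * (norm ?e)\<^sup>2 \<le> R y * norm ?e + c / 2 * norm ?e * norm ?e"
      using c(2)[of ?e] by linarith
    then have "norm ?e * (c / 2 * norm ?e) \<le> norm ?e * R y"
      by (simp add: power2_eq_square algebra_simps)
    moreover have "0 \<le> R y" unfolding R_def by (rule sum_nonneg) auto
    ultimately have "c / 2 * norm ?e \<le> R y"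
      by (cases "norm ?e = 0") (auto simp: mult_le_cancel_left)
    then show ?case using c(1) by (simp add: field_simps)
  qed
  moreover have "((\<lambda>y. 2 * R y / c) \<longlongrightarrow> 0) (at x)"
  proof -
    have "isCont (\<lambda>y. 2 * R y / c) x"
      unfolding R_def using c(1) by (intro continuous_intros cG c\<kappa>) auto
    moreover have "R x = 0" using sol[OF assms(2)] by (simp add: R_def)
    ultimately show ?thesis by (simp add: isCont_def)
  qed
  ultimately have "((\<lambda>y. w y - w x) \<longlongrightarrow> 0) (at x)" by (rule Lim_null_comparison)
  then show ?thesis by (simp add: isCont_def LIM_zero_cancel)
qed

text \<open>With the inner product frozen at x, G x (w y) z equals \<kappa> y z minus a sum of
  components of w times G y b z - G x b z. The components are continuous and the other factors
  vanish at x, so the sum is differentiable there. Riesz vectors of the coordinate functionals then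
  recover w, and the formula is the differentiated equation.\<close>

lemma differentiable_solution:
  fixes G :: "'a::euclidean_space \<Rightarrow> 'b::euclidean_space \<Rightarrow> 'b \<Rightarrow> real"
  assumes "open S" "x \<in> S" and G: "\<And>y. y \<in> S \<Longrightarrow> inner_product_on UNIV (G y)"
    and sol: "\<And>y z. y \<in> S \<Longrightarrow> G y (w y) z = \<kappa> y z"
    and dG: "\<And>a b. (\<lambda>y. G y a b) differentiable (at x)" and d\<kappa>: "\<And>z. (\<lambda>y. \<kappa> y z) differentiable (at x)"
  shows "w differentiable (at x)"
    and "G x (fd w x v) z = fd (\<lambda>y. \<kappa> y z) x v - fd (\<lambda>y. G y (w x) z) x v"
proof -
  have cont: "isCont w x"
    by (rule continuous_solution[OF assms(1-4) dG[THEN differentiable_imp_continuous_within]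
          d\<kappa>[THEN differentiable_imp_continuous_within]])
  have comp: "(\<lambda>y. G x (w y) z) differentiable (at x)" for z
  proof (rule differentiable_cong[OF assms(1,2)])
    show "(\<lambda>y. \<kappa> y z - (\<Sum>b\<in>Basis. (w y \<bullet> b) * (G y b z - G x b z))) differentiable (at x)"
      by (intro differentiable_diff differentiable_sum ballI finite_Basis d\<kappa> dG differentiable_const
          differentiable_continuous_mult_zero continuous_inner cont continuous_const diff_self)
    fix y assume "y \<in> S"
    then show "G x (w y) z = \<kappa> y z - (\<Sum>b\<in>Basis. (w y \<bullet> b) * (G y b z - G x b z))"
      using linear_basis_expansion[OF inner_product_linear(1)[OF G[OF \<open>y \<in> S\<close>]], of "w y" z]
        linear_basis_expansion[OF inner_product_linear(1)[OF G[OF \<open>x \<in> S\<close>]], of "w y" z] sol[of y z]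
      by (simp add: right_diff_distrib sum_subtractf)
  qed
  show d: "w differentiable (at x)"
  proof (rule differentiable_componentwise)
    fix b :: 'b
    have "linear (\<lambda>v. v \<bullet> b)" by (simp add: bounded_linear.linear bounded_linear_inner_left)
    then obtain n where "\<And>v. G x n v = v \<bullet> b" using riesz[OF G[OF assms(2)]] by blast
    then have "w y \<bullet> b = G x (w y) n" for y
      by (simp add: inner_product_onD(1)[OF G[OF assms(2)], of "w y" n])
    then show "(\<lambda>y. w y \<bullet> b) differentiable (at x)" using comp by simp
  qed
  have "fd (\<lambda>y. G y (w y) z) x v = fd (\<lambda>y. \<kappa> y z) x v"
    by (simp add: fd_cong[OF assms(1,2) sol])
  then show "G x (fd w x v) z = fd (\<lambda>y. \<kappa> y z) x v - fd (\<lambda>y. G y (w x) z) x v"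
    using fd_family(1)[OF assms(1,2) inner_product_linear(1)[OF G], where v=v, OF _ dG d] by simp
qed

text \<open>Bootstrapping: the derivative of w solves an equation with the same \<open>G\<close>,
  whose right-hand side contains first derivatives of \<kappa> and \<open>G\<close> but w itself
  undifferentiated. Hence the induction varies \<open>w\<close> and \<open>\<kappa>\<close>, and is
  used first for w and then for its derivative.\<close>

lemma ck_on_solution:
  fixes G :: "'a::euclidean_space \<Rightarrow> 'b::euclidean_space \<Rightarrow> 'b \<Rightarrow> real"
  assumes "open S" and G: "\<And>y. y \<in> S \<Longrightarrow> inner_product_on UNIV (G y)"
    and "\<And>a b. ck_on k S (\<lambda>y. G y a b)" "\<And>z. ck_on k S (\<lambda>y. \<kappa> y z)"
    and "\<And>y z. y \<in> S \<Longrightarrow> G y (w y) z = \<kappa> y z"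
  shows "ck_on k S w"
  using assms(3-)
proof (induction k arbitrary: w \<kappa>)
  case 0
  have "isCont w x" if "x \<in> S" for x
  proof (rule continuous_solution[OF assms(1) that G 0(3)])
    show "isCont (\<lambda>y. G y a b) x" for a b
      by (rule ck_on_0_isCont[OF 0(1) assms(1) that])
    show "isCont (\<lambda>y. \<kappa> y z) x" for z
      by (rule ck_on_0_isCont[OF 0(2) assms(1) that])
  qed
  then show ?case by (simp add: continuous_at_imp_continuous_on)
next
  case (Suc k)
  have dG: "(\<lambda>y. G y a b) differentiable (at x)" and d\<kappa>: "(\<lambda>y. \<kappa> y z) differentiable (at x)"
    if "x \<in> S" for x a b z
    by (rule ck_on_imp_differentiable[OF Suc.prems(1) that])
      (rule ck_on_imp_differentiable[OF Suc.prems(2) that])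
  have w: "w differentiable (at x)"
    "G x (fd w x v) z = fd (\<lambda>y. \<kappa> y z) x v - fd (\<lambda>y. G y (w x) z) x v" if x: "x \<in> S" for x v z
    by (rule differentiable_solution[OF assms(1) x G Suc.prems(3) dG[OF x] d\<kappa>[OF x]]; assumption)+
  have ckw: "ck_on k S w"
    by (rule Suc.IH[OF Suc.prems(1)[THEN ck_on_SucD] Suc.prems(2)[THEN ck_on_SucD] Suc.prems(3)])
  have "ck_on k S (\<lambda>x. fd w x v)" for v
  proof (rule Suc.IH[where \<kappa>="\<lambda>y z. fd (\<lambda>y. \<kappa> y z) y v - fd (\<lambda>u. G u (w y) z) y v"])
    show "ck_on k S (\<lambda>y. G y a b)" for a b by (rule ck_on_SucD[OF Suc.prems(1)])
    show "G y (fd w y v) z = fd (\<lambda>y. \<kappa> y z) y v - fd (\<lambda>u. G u (w y) z) y v" if "y \<in> S" for y z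
      by (rule w(2)[OF that])
    show "ck_on k S (\<lambda>y. fd (\<lambda>y. \<kappa> y z) y v - fd (\<lambda>u. G u (w y) z) y v)" for z
    proof (rule ck_on_diff[OF assms(1)])
      show "ck_on k S (\<lambda>y. fd (\<lambda>y. \<kappa> y z) y v)" by (rule ck_on_fd[OF Suc.prems(2)])
      show "ck_on k S (\<lambda>y. fd (\<lambda>u. G u (w y) z) y v)"
      proof (rule ck_on_family[where M="\<lambda>y a. fd (\<lambda>u. G u a z) y v", OF assms(1) _ _ ckw])
        show "linear (\<lambda>a. fd (\<lambda>u. G u a z) y v)" if "y \<in> S" for y
          by (rule linear_fd_family[where M="\<lambda>u a. G u a z", OF assms(1) that])
            (rule inner_product_linear(1)[OF G] dG[OF that], assumption?)+
        show "ck_on k S (\<lambda>y. fd (\<lambda>u. G u b z) y v)" for b by (rule ck_on_fd[OF Suc.prems(1)])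
      qed
    qed
  qed
  then show ?case by (metis ck_on.simps(2) w(1))
qed

section \<open>The Levi-Civita connection\<close>

lemma smooth_onI: "(\<And>k. ck_on k S f) \<Longrightarrow> smooth_on S f"
  by (simp add: smooth_on_def)

lemma smooth_onD: "smooth_on S f \<Longrightarrow> ck_on k S f"
  by (simp add: smooth_on_def)

locale smooth_metric =
  fixes S :: "'e::euclidean_space set" and G :: "'e local_metric"
  assumes open_S: "open S" and metric: "local_riemannian_metric S G"
begin

lemma ip: "x \<in> S \<Longrightarrow> inner_product_on UNIV (G x)"
  and smooth_G: "smooth_on S (\<lambda>x. G x u v)"
  using metric by (auto simp: local_riemannian_metric_def)

lemmas linear_G = inner_product_linear[OF ip]
lemmas diff_G = smooth_on_imp_differentiable[OF smooth_G]

lemma sym_G: "x \<in> S \<Longrightarrow> G x u v = G x v u"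
  using inner_product_onD(1)[OF ip] by simp

lemma eq_G: "x \<in> S \<Longrightarrow> (\<And>z. G x u z = G x v z) \<Longrightarrow> u = v"
  by (rule inner_product_eqI[OF ip])

lemma fd_G:
  assumes "x \<in> S" "Y differentiable (at x)" "Z differentiable (at x)"
  shows "fd (\<lambda>y. G y (Y y) (Z y)) x v
    = fd (\<lambda>y. G y (Y x) (Z x)) x v + G x (fd Y x v) (Z x) + G x (Y x) (fd Z x v)"
  by (rule fd_family2(1)[OF open_S assms(1) linear_G diff_G[OF assms(1)] assms(2,3)])

lemma linear_fd_G:
  assumes "x \<in> S"
  shows "linear (\<lambda>z. fd (\<lambda>y. G y v z) x u)" "linear (\<lambda>v. fd (\<lambda>y. G y v z) x u)"
    "linear (\<lambda>u. fd (\<lambda>y. G y v z) x u)"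
  by (rule linear_fd_family[where M="\<lambda>y z. G y v z", OF open_S assms linear_G(2) diff_G[OF assms]]
      linear_fd_family[where M="\<lambda>y v. G y v z", OF open_S assms linear_G(1) diff_G[OF assms]]
      linear_fd[OF diff_G[OF assms]]; assumption)+

text \<open>The right-hand side is linear in z, so Riesz and definiteness make the definite
  description meaningful.\<close>

lemma christoffel_spec:
  assumes "x \<in> S"
  shows "2 * G x (christoffel G x u v) z = fd (\<lambda>y. G y v z) x u + fd (\<lambda>y. G y u z) x v - fd (\<lambda>y. G y u v) x z"
proof -
  let ?\<kappa> = "\<lambda>z. fd (\<lambda>y. G y v z) x u + fd (\<lambda>y. G y u z) x v - fd (\<lambda>y. G y u v) x z"
  have "linear (\<lambda>z. (1/2) *\<^sub>R ?\<kappa> z)"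
    by (intro linear_compose_scale_right linear_compose_sub linear_compose_add linear_fd_G assms)
  then obtain w where "\<And>z. G x w z = (1/2) *\<^sub>R ?\<kappa> z" using riesz[OF ip[OF assms]] by blast
  then have w: "\<forall>z. 2 * G x w z = ?\<kappa> z" by (simp add: mult.commute)
  have "\<exists>!w. \<forall>z. 2 * G x w z = ?\<kappa> z"
  proof (rule ex1I[of _ w])
    fix w' assume "\<forall>z. 2 * G x w' z = ?\<kappa> z"
    then have "G x w' z = G x w z" for z using w by (metis mult_cancel_left zero_neq_numeral)
    then show "w' = w" by (rule eq_G[OF assms])
  qed (rule w)
  from theI'[OF this] show ?thesis unfolding christoffel_def by simp
qed

lemma christoffel_sym: "x \<in> S \<Longrightarrow> christoffel G x u v = christoffel G x v u"
proof (rule eq_G)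
  fix z assume x: "x \<in> S"
  have "fd (\<lambda>y. G y u v) x = fd (\<lambda>y. G y v u) x"
    by (rule fd_cong[OF open_S x]) (rule sym_G)
  then show "G x (christoffel G x u v) z = G x (christoffel G x v u) z"
    using christoffel_spec[OF x, of u v z] christoffel_spec[OF x, of v u z] by simp
qed

lemma linear_christoffel:
  assumes x: "x \<in> S"
  shows "linear (\<lambda>u. christoffel G x u v)" "linear (christoffel G x u)"
proof -
  show l: "linear (\<lambda>u. christoffel G x u v)" for v
  proof (rule linearI)
    fix u u' r
    show "christoffel G x (u + u') v = christoffel G x u v + christoffel G x u' v"
    proof (rule eq_G[OF x])
      fix z
      show "G x (christoffel G x (u + u') v) z = G x (christoffel G x u v + christoffel G x u' v) z"
        using christoffel_spec[OF x, of u v z] christoffel_spec[OF x, of u' v z]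
          christoffel_spec[OF x, of "u + u'" v z]
        by (simp add: linear_add[OF linear_G(1)[OF x]] linear_add[OF linear_fd_G(2)[OF x]]
            linear_add[OF linear_fd_G(3)[OF x]])
    qed
    show "christoffel G x (r *\<^sub>R u) v = r *\<^sub>R christoffel G x u v"
    proof (rule eq_G[OF x])
      fix z
      have "2 * G x (christoffel G x (r *\<^sub>R u) v) z = r * (2 * G x (christoffel G x u v) z)"
        unfolding christoffel_spec[OF x]
        by (simp add: linear_scale[OF linear_fd_G(2)[OF x]] linear_scale[OF linear_fd_G(3)[OF x]]
            algebra_simps)
      then show "G x (christoffel G x (r *\<^sub>R u) v) z = G x (r *\<^sub>R christoffel G x u v) z"
        by (simp add: linear_scale[OF linear_G(1)[OF x]])
    qed
  qed
  have "(\<lambda>v. christoffel G x v u) = christoffel G x u"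
    by (rule ext) (rule christoffel_sym[OF x])
  then show "linear (christoffel G x u)" using l[of u] by simp
qed

lemma smooth_christoffel: "smooth_on S (\<lambda>x. christoffel G x u v)"
proof (rule smooth_onI, rule ck_on_solution[where G=G and \<kappa>="\<lambda>x z. (1/2) *
    (fd (\<lambda>y. G y v z) x u + fd (\<lambda>y. G y u z) x v - fd (\<lambda>y. G y u v) x z)", OF open_S ip])
  show "ck_on k S (\<lambda>y. G y a b)" for k a b by (rule smooth_onD[OF smooth_G])
  show "ck_on k S (\<lambda>x. (1/2) * (fd (\<lambda>y. G y v z) x u + fd (\<lambda>y. G y u z) x v - fd (\<lambda>y. G y u v) x z))" for k z
    by (intro ck_on_mult[OF open_S] ck_on_const ck_on_add[OF open_S] ck_on_diff[OF open_S]
        smooth_onD[OF smooth_on_fd[OF smooth_G]])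
  show "G y (christoffel G y u v) z = (1/2) *
      (fd (\<lambda>y. G y v z) y u + fd (\<lambda>y. G y u z) y v - fd (\<lambda>y. G y u v) y z)" if "y \<in> S" for y z
    using christoffel_spec[OF that, of u v z] by simp
qed

lemma smooth_levi_civita:
  assumes "smooth_on S X" "smooth_on S Y"
  shows "smooth_on S (levi_civita G X Y)"
proof (rule smooth_onI)
  fix k
  have "ck_on k S (\<lambda>x. fd Y x (X x))"
    by (rule ck_on_family[OF open_S linear_fd[OF smooth_on_imp_differentiable[OF assms(2)]]
          smooth_onD[OF smooth_on_fd[OF assms(2)]] smooth_onD[OF assms(1)]])
  moreover have "ck_on k S (\<lambda>x. christoffel G x (X x) (Y x))"
    by (rule ck_on_family2[OF open_S linear_christoffel smooth_onD[OF smooth_christoffel]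
          smooth_onD[OF assms(1)] smooth_onD[OF assms(2)]])
  ultimately have "ck_on k S (\<lambda>x. fd Y x (X x) + christoffel G x (X x) (Y x))"
    by (rule ck_on_add[OF open_S])
  then show "ck_on k S (levi_civita G X Y)"
    by (simp only: levi_civita_def[abs_def])
qed

lemma metric_compatible:
  assumes x: "x \<in> S" and "Y differentiable (at x)" "Z differentiable (at x)"
  shows "fd (\<lambda>y. G y (Y y) (Z y)) x (X x)
    = G x (levi_civita G X Y x) (Z x) + G x (Y x) (levi_civita G X Z x)"
proof -
  have "fd (\<lambda>y. G y (Z x) (Y x)) x = fd (\<lambda>y. G y (Y x) (Z x)) x"
    by (rule fd_cong[OF open_S x]) (rule sym_G)
  then have "fd (\<lambda>y. G y (Y x) (Z x)) x (X x)
      = G x (christoffel G x (X x) (Y x)) (Z x) + G x (Y x) (christoffel G x (X x) (Z x))"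
    using christoffel_spec[OF x, of "X x" "Y x" "Z x"] christoffel_spec[OF x, of "X x" "Z x" "Y x"]
    by (simp add: sym_G[OF x, of "Y x"])
  then show ?thesis
    by (simp add: fd_G[OF assms] levi_civita_def linear_add[OF linear_G(1)[OF x]]
        linear_add[OF linear_G(2)[OF x]])
qed

lemma torsion_free:
  "x \<in> S \<Longrightarrow> levi_civita G X Y x - levi_civita G Y X x = lie_bracket X Y x"
  by (simp add: levi_civita_def lie_bracket_def christoffel_sym[of x "X x" "Y x"])

lemma koszul:
  assumes x: "x \<in> S"
    and d: "X differentiable (at x)" "Y differentiable (at x)" "Z differentiable (at x)"
  shows "2 * G x (levi_civita G X Y x) (Z x) =
      fd (\<lambda>y. G y (Y y) (Z y)) x (X x) + fd (\<lambda>y. G y (X y) (Z y)) x (Y x)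
    - fd (\<lambda>y. G y (X y) (Y y)) x (Z x) + G x (lie_bracket X Y x) (Z x)
    - G x (lie_bracket X Z x) (Y x) - G x (lie_bracket Y Z x) (X x)"
  by (simp add: metric_compatible[OF x] d linear_diff[OF linear_G(1)[OF x]] sym_G[OF x, of "X x"]
      sym_G[OF x, of "Y x"] flip: torsion_free[OF x])

lemma fd_levi_civita:
  assumes x: "x \<in> S" and X: "smooth_on S X" and Y: "smooth_on S Y"
  shows "fd (levi_civita G X Y) x v =
      fd (\<lambda>y. fd Y y (X x)) x v + fd Y x (fd X x v) + fd (\<lambda>y. christoffel G y (X x) (Y x)) x v
    + christoffel G x (fd X x v) (Y x) + christoffel G x (X x) (fd Y x v)"
proof -
  note dX = smooth_on_imp_differentiable[OF X] and dY = smooth_on_imp_differentiable[OF Y]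
  note ddY = smooth_on_imp_differentiable[OF smooth_on_fd[OF Y] x]
  note d\<Gamma> = smooth_on_imp_differentiable[OF smooth_christoffel x]
  have "fd (levi_civita G X Y) x v
      = fd (\<lambda>y. fd Y y (X y)) x v + fd (\<lambda>y. christoffel G y (X y) (Y y)) x v"
    unfolding levi_civita_def[abs_def]
    by (rule fd_add fd_family(2)[OF open_S x linear_fd[OF dY] ddY dX[OF x]]
        fd_family2(2)[OF open_S x linear_christoffel d\<Gamma> dX[OF x] dY[OF x]]; assumption?)+
  moreover have "fd (\<lambda>y. fd Y y (X y)) x v = fd (\<lambda>y. fd Y y (X x)) x v + fd Y x (fd X x v)"
    by (rule fd_family(1)[OF open_S x linear_fd[OF dY] ddY dX[OF x]])
  moreover have "fd (\<lambda>y. christoffel G y (X y) (Y y)) x v = fd (\<lambda>y. christoffel G y (X x) (Y x)) x v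
    + christoffel G x (fd X x v) (Y x) + christoffel G x (X x) (fd Y x v)"
    by (rule fd_family2(1)[OF open_S x linear_christoffel d\<Gamma> dX[OF x] dY[OF x]])
  ultimately show ?thesis by simp
qed

text \<open>This passes from the constant coordinate fields in the definition of
  \<open>curvature\<close> to fields adapted to the submersion. The bracket term absorbs the first
  derivatives of X and Y, and the second derivatives of Z cancel by symmetry.\<close>

lemma curvature_fields:
  assumes x: "x \<in> S" and X: "smooth_on S X" and Y: "smooth_on S Y" and Z: "smooth_on S Z"
  shows "curvature G x (X x) (Y x) (Z x) = levi_civita G X (levi_civita G Y Z) x
    - levi_civita G Y (levi_civita G X Z) x - levi_civita G (lie_bracket X Y) Z x"
proof -
  have const: "levi_civita G (\<lambda>_. a) (\<lambda>_. b) = (\<lambda>y. christoffel G y a b)" for a b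
    by (simp add: levi_civita_def fun_eq_iff)
  have "fd (\<lambda>y. fd Z y (Y x)) x (X x) = fd (\<lambda>y. fd Z y (X x)) x (Y x)"
    by (rule fd_symmetric[OF open_S x smooth_onD[OF Z]])
  moreover have "linear (fd Z x)" by (rule linear_fd[OF smooth_on_imp_differentiable[OF Z x]])
  ultimately show ?thesis
    unfolding curvature_def const
    unfolding levi_civita_def[of G _ "levi_civita G _ _"] levi_civita_def[of G _ "\<lambda>y. christoffel G y _ _"]
      fd_levi_civita[OF x X Z] fd_levi_civita[OF x Y Z]
    by (simp add: levi_civita_def lie_bracket_def linear_add[OF linear_christoffel(2)[OF x]]
      linear_diff[OF linear_christoffel(1)[OF x]] linear_diff)
qed

end

section \<open>Riemannian submersions\<close>

text \<open>For data living on \<open>Q\<close> only: precomposed with the projection, the base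
  metric becomes a bilinear form on the whole space, as the calculus of families demands; in the
  open mapping argument, e - p e fills the directions missing from \<open>Q\<close>.\<close>

lemma linear_projection_exists:
  fixes Q :: "'a::euclidean_space set"
  assumes "subspace Q"
  obtains p where "linear p" "\<And>v. p v \<in> Q" "\<And>v. v \<in> Q \<Longrightarrow> p v = v"
proof -
  obtain p where "p ` UNIV \<subseteq> Q" "linear p" "\<forall>v\<in>(\<lambda>v. v) ` Q. p v = v"
    using linear_exists_right_inverse_on[OF linear_ident assms] by auto
  then show ?thesis using that[of p] by auto
qed

text \<open>If the derivative of \<open>F\<close> did not vanish on the kernel, then \<open>(\<pi>, F)\<close>, stabilised by a
  complement of \<open>Q\<close>, would be an open map, so \<open>F\<close> would not be constant on the fibres of \<open>\<pi>\<close>.\<close>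

lemma fd_fibre_constant:
  fixes \<pi> :: "'a::euclidean_space \<Rightarrow> 'b::euclidean_space" and F :: "'a \<Rightarrow> real"
  assumes S: "open S" "x \<in> S" and Q: "subspace Q" "\<pi> ` S \<subseteq> Q" "range (fd \<pi> x) = Q"
    and d\<pi>: "\<And>y. y \<in> S \<Longrightarrow> \<pi> differentiable (at y)"
    and dF: "\<And>y. y \<in> S \<Longrightarrow> F differentiable (at y)"
    and fibre: "\<And>y z. y \<in> S \<Longrightarrow> z \<in> S \<Longrightarrow> \<pi> y = \<pi> z \<Longrightarrow> F y = F z"
    and v: "fd \<pi> x v = 0"
  shows "fd F x v = 0"
proof (rule ccontr)
  assume c: "fd F x v \<noteq> 0"
  note l\<pi> = linear_fd[OF d\<pi>[OF S(2)]] and lF = linear_fd[OF dF[OF S(2)]]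
  obtain p where p: "linear p" "\<And>v. p v \<in> Q" "\<And>v. v \<in> Q \<Longrightarrow> p v = v"
    using linear_projection_exists[OF Q(1)] by blast
  obtain s where s: "linear s" "\<And>b. b \<in> Q \<Longrightarrow> fd \<pi> x (s b) = b"
    using linear_exists_right_inverse_on[OF l\<pi> subspace_UNIV] Q(3) by auto
  define \<Phi> where "\<Phi> = (\<lambda>(y, e). (\<pi> y + (e - p e), F y))"
  define \<Phi>' where "\<Phi>' = (\<lambda>(a, e). (fd \<pi> x a + (e - p e), fd F x a))"
  \<comment> \<open>A right inverse of \<open>\<Phi>'\<close>: \<open>s (p b)\<close> reaches the
    part of b in \<open>Q\<close>, the multiple of v, invisible to \<open>fd \<pi> x\<close>,
    corrects the last component to t, and e = b supplies b - p b.\<close>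
  define r where "r = (\<lambda>(b, t). (s (p b) + ((t - fd F x (s (p b))) / fd F x v) *\<^sub>R v, b))"
  have ls: "linear (\<lambda>b. s (p b))" using linear_compose[OF p(1) s(1)] by (simp add: o_def)
  have bl: "bounded_linear p" using p(1) by (simp add: linear_conv_bounded_linear)
  have fst': "((\<lambda>z. \<pi> (fst z)) has_derivative (\<lambda>h. fd \<pi> (fst z) (fst h))) (at z)"
    "((\<lambda>z. F (fst z)) has_derivative (\<lambda>h. fd F (fst z) (fst h))) (at z)" if "fst z \<in> S"
    for z :: "'a \<times> 'b"
    using that by (auto intro!: has_derivative_compose[OF has_derivative_fst[OF has_derivative_ident]]
        has_derivative_fd d\<pi> dF)
  have der: "(\<Phi> has_derivative (\<lambda>h. (fd \<pi> (fst z) (fst h) + (snd h - p (snd h)), fd F (fst z) (fst h)))) (at z)"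
    if "fst z \<in> S" for z
    unfolding \<Phi>_def case_prod_beta
    by (intro has_derivative_Pair has_derivative_add has_derivative_diff fst' that
        bounded_linear.has_derivative[OF bl] has_derivative_snd has_derivative_ident)
  have "\<Phi> (x, 0) \<in> interior (\<Phi> ` (S \<times> UNIV))"
  proof (rule sussmann_open_mapping[where S="S \<times> UNIV" and f'="\<Phi>'" and g'=r])
    show "open (S \<times> (UNIV :: 'b set))" using S(1) by (simp add: open_Times)
    then show "(x, 0) \<in> interior (S \<times> (UNIV :: 'b set))" using S(2) by (subst interior_open) auto
    show "continuous_on (S \<times> UNIV) \<Phi>"
      by (intro continuous_at_imp_continuous_on ballI has_derivative_continuous[OF der]) auto
    show "(\<Phi> has_derivative \<Phi>') (at (x, 0))"
      using der[of "(x, 0)"] S(2) by (simp add: \<Phi>'_def case_prod_unfold)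
    have "linear r"
      unfolding r_def case_prod_beta
      by (rule linearI) (simp_all add: linear_add[OF ls] linear_scale[OF ls] linear_add[OF lF]
          linear_scale[OF lF] add_divide_distrib diff_divide_distrib algebra_simps)
    then show "bounded_linear r" by (simp add: linear_conv_bounded_linear)
    show "\<Phi>' \<circ> r = id"
    proof
      fix bt :: "'b \<times> real"
      show "(\<Phi>' \<circ> r) bt = id bt"
        using c by (cases bt) (simp add: \<Phi>'_def r_def linear_add[OF l\<pi>] linear_scale[OF l\<pi>] v
            linear_add[OF lF] linear_scale[OF lF] s(2) p(2))
    qed
  qed (use S(2) in auto)
  then obtain \<epsilon> where \<epsilon>: "\<epsilon> > 0" "ball (\<Phi> (x, 0)) \<epsilon> \<subseteq> \<Phi> ` (S \<times> UNIV)"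
    by (auto simp: mem_interior)
  have "(\<pi> x, F x + \<epsilon> / 2) \<in> ball (\<Phi> (x, 0)) \<epsilon>"
    using \<epsilon>(1) linear_0[OF p(1)] by (simp add: \<Phi>_def dist_Pair_Pair dist_real_def)
  then obtain y e where y: "y \<in> S" "\<pi> y + (e - p e) = \<pi> x" "F y = F x + \<epsilon> / 2"
    using \<epsilon>(2) by (force simp: \<Phi>_def)
  \<comment> \<open>The projection kills the stabilising summand e - p e, so y lies on the fibre of
    x although F y differs from F x.\<close>
  have "p (\<pi> y) + (p e - p (p e)) = p (\<pi> x)"
    by (simp only: y(2)[symmetric] linear_add[OF p(1)] linear_diff[OF p(1)])
  then have "\<pi> y = \<pi> x" using p Q(2) S(2) y(1) by (simp add: image_subset_iff)
  then show False using fibre[OF y(1) S(2)] y(3) \<epsilon>(1) by simp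
qed

locale submersion_metric = smooth_metric S G
  for S :: "'a::euclidean_space set" and G :: "'a local_metric" +
  fixes Q :: "'a set" and h :: "'a local_metric" and \<pi> :: "'a \<Rightarrow> 'a"
  assumes Q: "subspace Q" and sub: "riemannian_submersion S G Q h \<pi>"
begin

lemma smooth_\<pi>: "smooth_on S \<pi>"
  and \<pi>_in_Q: "x \<in> S \<Longrightarrow> \<pi> x \<in> Q"
  and range_\<pi>: "x \<in> S \<Longrightarrow> range (fd \<pi> x) = Q"
  and ip_h: "x \<in> S \<Longrightarrow> inner_product_on Q (h (\<pi> x))"
  and smooth_h: "a \<in> Q \<Longrightarrow> b \<in> Q \<Longrightarrow> smooth_on S (\<lambda>x. h (\<pi> x) a b)"
  using sub unfolding riemannian_submersion_def by blast+

lemmas diff_\<pi> = smooth_on_imp_differentiable[OF smooth_\<pi>]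
lemmas linear_\<pi> = linear_fd[OF diff_\<pi>]

lemma fd_\<pi>_in_Q [simp]: "x \<in> S \<Longrightarrow> fd \<pi> x u \<in> Q"
  using range_\<pi> by blast

text \<open>Stated with the kernel of the derivative of \<pi>, not with the foliation, so that the
  predicate can be compared for the original and the rescaled metric.\<close>

definition hor_vec :: "'a \<Rightarrow> 'a \<Rightarrow> bool" where
  "hor_vec x u \<longleftrightarrow> (\<forall>v. fd \<pi> x v = 0 \<longrightarrow> G x u v = 0)"

lemma isometric: "x \<in> S \<Longrightarrow> hor_vec x u \<Longrightarrow> hor_vec x v \<Longrightarrow> h (\<pi> x) (fd \<pi> x u) (fd \<pi> x v) = G x u v"
  using sub unfolding riemannian_submersion_def hor_vec_def horizontal_def by (auto simp: Let_def)

lemma h_zero: "x \<in> S \<Longrightarrow> a \<in> Q \<Longrightarrow> h (\<pi> x) a 0 = 0" "x \<in> S \<Longrightarrow> a \<in> Q \<Longrightarrow> h (\<pi> x) 0 a = 0"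
  using inner_product_onD(1)[OF ip_h, of x 0 a] inner_product_onD(3)[OF ip_h, of x 0 a 0] subspace_0[OF Q]
  by simp_all

lemma h_bilinear:
  assumes "linear p" "\<And>v. p v \<in> Q" "x \<in> S"
  shows "linear (\<lambda>a. h (\<pi> x) (p a) (p b))" "linear (\<lambda>b. h (\<pi> x) (p a) (p b))"
proof -
  show l: "linear (\<lambda>a. h (\<pi> x) (p a) (p b))" for b
    by (rule linearI)
      (simp_all add: linear_add[OF assms(1)] linear_scale[OF assms(1)]
        inner_product_onD(2,3)[OF ip_h[OF assms(3)]] assms(2))
  have "(\<lambda>b. h (\<pi> x) (p b) (p a)) = (\<lambda>b. h (\<pi> x) (p a) (p b))"
    by (rule ext) (rule inner_product_onD(1)[OF ip_h[OF assms(3)] assms(2,2)])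
  then show "linear (\<lambda>b. h (\<pi> x) (p a) (p b))" using l[of a] by simp
qed

lemma linear_h_\<pi>:
  assumes "x \<in> S" "a \<in> Q"
  shows "linear (\<lambda>z. h (\<pi> x) a (fd \<pi> x z))"
proof -
  obtain b where "a = fd \<pi> x b" using range_\<pi>[OF assms(1)] assms(2) by blast
  then show ?thesis
    using h_bilinear(2)[OF linear_\<pi> fd_\<pi>_in_Q, OF assms(1) assms(1) assms(1)] by simp
qed

lemma smooth_h_fields:
  assumes "smooth_on S Y" "smooth_on S Z" "\<And>y. y \<in> S \<Longrightarrow> Y y \<in> Q" "\<And>y. y \<in> S \<Longrightarrow> Z y \<in> Q"
  shows "smooth_on S (\<lambda>y. h (\<pi> y) (Y y) (Z y))"
proof (rule smooth_onI)
  fix k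
  obtain p where p: "linear p" "\<And>v. p v \<in> Q" "\<And>v. v \<in> Q \<Longrightarrow> p v = v"
    using linear_projection_exists[OF Q] by blast
  have "ck_on k S (\<lambda>y. h (\<pi> y) (p (Y y)) (p (Z y)))"
    by (rule ck_on_family2[where M="\<lambda>y a b. h (\<pi> y) (p a) (p b)", OF open_S h_bilinear[OF p(1,2)]
        smooth_onD[OF smooth_h[OF p(2) p(2)]] smooth_onD[OF assms(1)] smooth_onD[OF assms(2)]])
  then show "ck_on k S (\<lambda>y. h (\<pi> y) (Y y) (Z y))"
    by (subst ck_on_cong[OF open_S, where g="\<lambda>y. h (\<pi> y) (p (Y y)) (p (Z y))"])
      (simp_all add: p(3) assms(3,4))
qed

text \<open>The function is constant on the fibres of \<pi>. The chain rule does not apply, as h is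
  smooth only in composition with \<pi>.\<close>

lemma fd_h_vertical:
  assumes x: "x \<in> S" and v: "fd \<pi> x v = 0" and ab: "a \<in> Q" "b \<in> Q"
  shows "fd (\<lambda>y. h (\<pi> y) a b) x v = 0"
  by (rule fd_fibre_constant[OF open_S x Q _ range_\<pi>[OF x] diff_\<pi>
        smooth_on_imp_differentiable[OF smooth_h[OF ab]] _ v]) (use \<pi>_in_Q in auto)

text \<open>The horizontal lift of a base vector, encoded as the adjoint of the derivative of \<pi>;
  the two agree for a Riemannian submersion. As the solution of a linear equation it falls under
  \<open>ck_on_solution\<close>.\<close>

definition lift :: "'a \<Rightarrow> 'a \<Rightarrow> 'a" where
  "lift a x = (THE w. \<forall>z. G x w z = h (\<pi> x) a (fd \<pi> x z))"

lemma lift_spec: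
  assumes "x \<in> S" "a \<in> Q"
  shows "G x (lift a x) z = h (\<pi> x) a (fd \<pi> x z)"
proof -
  obtain w where w: "\<forall>z. G x w z = h (\<pi> x) a (fd \<pi> x z)"
    using riesz[OF ip[OF assms(1)] linear_h_\<pi>[OF assms]] by blast
  have "\<exists>!w. \<forall>z. G x w z = h (\<pi> x) a (fd \<pi> x z)"
  proof (rule ex1I[of _ w])
    fix w' assume "\<forall>z. G x w' z = h (\<pi> x) a (fd \<pi> x z)"
    then show "w' = w" by (intro eq_G[OF assms(1)]) (simp add: w)
  qed (rule w)
  from theI'[OF this] show ?thesis unfolding lift_def by simp
qed

lemma hor_lift: "x \<in> S \<Longrightarrow> a \<in> Q \<Longrightarrow> hor_vec x (lift a x)"
  by (simp add: hor_vec_def lift_spec h_zero)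

lemma linear_lift:
  assumes x: "x \<in> S"
  shows "linear (\<lambda>z. lift (fd \<pi> x z) x)"
proof (rule linearI; rule eq_G[OF x])
  note l = h_bilinear(1)[OF linear_\<pi>[OF x] fd_\<pi>_in_Q[OF x] x]
  fix u v z r
  show "G x (lift (fd \<pi> x (u + v)) x) z = G x (lift (fd \<pi> x u) x + lift (fd \<pi> x v) x) z"
    using linear_add[OF l, of u v z] by (simp add: linear_add[OF linear_G(1)[OF x]] lift_spec x)
  show "G x (lift (fd \<pi> x (r *\<^sub>R u)) x) z = G x (r *\<^sub>R lift (fd \<pi> x u) x) z"
    using linear_scale[OF l, of r u z] by (simp add: linear_scale[OF linear_G(1)[OF x]] lift_spec x)
qed

text \<open>Let D be the derivative of \<pi>, \<open>H\<close> its composition with the adjoint, and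
  e = H z - z. Since D is isometric on horizontal vectors, D e is h-orthogonal to D v for every
  horizontal v. Taking v = H e gives G (H e) (H e) = 0, so H e = 0, then h (D e) (D e) = G (H e) e =
  0, so D e = 0.\<close>

lemma fd_\<pi>_lift:
  assumes x: "x \<in> S" and a: "a \<in> Q"
  shows "fd \<pi> x (lift a x) = a"
proof -
  obtain z where z: "a = fd \<pi> x z" using range_\<pi>[OF x] a by blast
  define H where "H u = lift (fd \<pi> x u) x" for u
  have H: "hor_vec x (H u)" "G x (H u) v = h (\<pi> x) (fd \<pi> x u) (fd \<pi> x v)" for u v
    using x by (simp_all add: H_def hor_lift lift_spec)
  note l = h_bilinear(1)[OF linear_\<pi>[OF x] fd_\<pi>_in_Q[OF x] x]
  define e where "e = H z - z"
  have "h (\<pi> x) (fd \<pi> x e) (fd \<pi> x v) = 0" if "hor_vec x v" for v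
    using isometric[OF x H(1) that, of z] H(2)[of z v] linear_diff[OF l, of "H z" z v] by (simp add: e_def)
  then have "G x (H e) (H e) = 0" using H by simp
  then have "H e = 0" using inner_product_onD(4)[OF ip[OF x], of "H e"] by (cases "H e = 0") auto
  then have "h (\<pi> x) (fd \<pi> x e) (fd \<pi> x e) = 0"
    using H(2)[of e e] linear_0[OF linear_G(1)[OF x]] by simp
  then have "fd \<pi> x e = 0"
    using inner_product_onD(4)[OF ip_h[OF x], of "fd \<pi> x e" "fd \<pi> x e"] x by (cases "fd \<pi> x e = 0") auto
  then show ?thesis by (simp add: e_def linear_diff[OF linear_\<pi>[OF x]] H_def z)
qed

text \<open>The difference is horizontal and lies in the kernel, so it is orthogonal to
  itself.\<close>

lemma lift_fd_\<pi>:
  assumes x: "x \<in> S" and u: "hor_vec x u"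
  shows "lift (fd \<pi> x u) x = u"
proof -
  let ?e = "lift (fd \<pi> x u) x - u"
  have "fd \<pi> x ?e = 0" by (simp add: linear_diff[OF linear_\<pi>[OF x]] fd_\<pi>_lift x)
  then have "G x ?e ?e = 0"
    using hor_lift[OF x fd_\<pi>_in_Q[OF x], of u] u
    by (simp add: linear_diff[OF linear_G(1)[OF x], of _ _ ?e] hor_vec_def)
  then show ?thesis using inner_product_onD(4)[OF ip[OF x], of ?e] by (cases "?e = 0") auto
qed

lemma smooth_lift_field:
  assumes "smooth_on S Y" "\<And>y. y \<in> S \<Longrightarrow> Y y \<in> Q"
  shows "smooth_on S (\<lambda>y. lift (Y y) y)"
proof (rule smooth_onI, rule ck_on_solution[where G=G and \<kappa>="\<lambda>y z. h (\<pi> y) (Y y) (fd \<pi> y z)", OF open_S ip])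
  fix k a b z
  show "ck_on k S (\<lambda>y. G y a b)" by (rule smooth_onD[OF smooth_G])
  show "ck_on k S (\<lambda>y. h (\<pi> y) (Y y) (fd \<pi> y z))"
    by (rule smooth_onD[OF smooth_h_fields[OF assms(1) smooth_on_fd[OF smooth_\<pi>] assms(2)]]) simp_all
next
  show "G y (lift (Y y) y) z = h (\<pi> y) (Y y) (fd \<pi> y z)" if "y \<in> S" for y z
    by (rule lift_spec[OF that assms(2)[OF that]])
qed

text \<open>The orthogonal projections, written through \<open>lift\<close> because their smoothness
  is then at hand; \<open>vpart_eq\<close> identifies them with \<open>hpart\<close> and
  \<open>vpart\<close>.\<close>

definition hor :: "'a \<Rightarrow> 'a \<Rightarrow> 'a" where "hor u y = lift (fd \<pi> y u) y"
definition ver :: "'a \<Rightarrow> 'a \<Rightarrow> 'a" where "ver u y = u - hor u y"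

lemma smooth_hor: "smooth_on S (hor u)"
  unfolding hor_def[abs_def] by (rule smooth_lift_field[OF smooth_on_fd[OF smooth_\<pi>]]) simp

lemma smooth_ver: "smooth_on S (ver u)"
  unfolding ver_def[abs_def]
  by (intro smooth_onI ck_on_diff[OF open_S] ck_on_const smooth_onD[OF smooth_hor])

lemma hor_vec_hor: "x \<in> S \<Longrightarrow> hor_vec x (hor u x)"
  by (simp add: hor_def hor_lift)

lemma fd_\<pi>_hor: "x \<in> S \<Longrightarrow> fd \<pi> x (hor u x) = fd \<pi> x u"
  by (simp add: hor_def fd_\<pi>_lift)

lemma fd_\<pi>_ver:
  assumes "x \<in> S"
  shows "fd \<pi> x (ver u x) = 0"
  by (simp add: ver_def linear_diff[OF linear_\<pi>[OF assms]] fd_\<pi>_hor assms)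

lemma hor_eq: "x \<in> S \<Longrightarrow> hor_vec x u \<Longrightarrow> hor u x = u"
  by (simp add: hor_def lift_fd_\<pi>)

lemma hor_vertical: "x \<in> S \<Longrightarrow> fd \<pi> x u = 0 \<Longrightarrow> hor u x = 0"
  using linear_0[OF linear_lift[of x]] linear_0[OF linear_\<pi>[of x]] by (simp add: hor_def)

lemma ver_eq: "x \<in> S \<Longrightarrow> fd \<pi> x u = 0 \<Longrightarrow> ver u x = u"
  by (simp add: ver_def hor_vertical)

lemma hor_add_ver: "hor u x + ver u x = u"
  by (simp add: ver_def)

lemma G_hor: "x \<in> S \<Longrightarrow> G x (hor u x) v = h (\<pi> x) (fd \<pi> x u) (fd \<pi> x v)"
  by (simp add: hor_def lift_spec)

lemma vpart_eq:
  assumes x: "x \<in> S" and V: "V x = {u. fd \<pi> x u = 0}"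
  shows "vpart G V x u = ver u x" "hpart G V x u = hor u x"
proof -
  have "horizontal G V x = {u. hor_vec x u}" by (auto simp: horizontal_def hor_vec_def V)
  then have "vpart G V x u = (THE w. fd \<pi> x w = 0 \<and> hor_vec x (u - w))"
    by (simp add: vpart_def V)
  also have "\<dots> = ver u x"
  proof (rule the_equality)
    show "fd \<pi> x (ver u x) = 0 \<and> hor_vec x (u - ver u x)"
      using fd_\<pi>_ver[OF x] hor_vec_hor[OF x] by (simp add: ver_def)
    fix w assume w: "fd \<pi> x w = 0 \<and> hor_vec x (u - w)"
    then have "u - w = lift (fd \<pi> x (u - w)) x" using lift_fd_\<pi>[OF x] by simp
    then show "w = ver u x"
      using w by (simp add: ver_def hor_def linear_diff[OF linear_\<pi>[OF x]] algebra_simps)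
  qed
  finally show "vpart G V x u = ver u x" .
  then show "hpart G V x u = hor u x" by (simp add: hpart_def ver_def)
qed

section \<open>Covariant derivatives of basic and vertical fields\<close>

definition basic :: "'a \<Rightarrow> ('a \<Rightarrow> 'a) \<Rightarrow> bool" where
  "basic a X \<longleftrightarrow> smooth_on S X \<and> (\<forall>y\<in>S. fd \<pi> y (X y) = a \<and> hor_vec y (X y))"

definition vert :: "('a \<Rightarrow> 'a) \<Rightarrow> bool" where
  "vert \<xi> \<longleftrightarrow> smooth_on S \<xi> \<and> (\<forall>y\<in>S. fd \<pi> y (\<xi> y) = 0)"

lemma basic_lift: "a \<in> Q \<Longrightarrow> basic a (lift a)"
  unfolding basic_def using smooth_lift_field[OF smooth_on_const, of a]
  by (simp add: fd_\<pi>_lift hor_lift)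

lemma vert_ver: "vert (ver u)"
  by (simp add: vert_def smooth_ver fd_\<pi>_ver)

lemma basicD:
  assumes "basic a X"
  shows "smooth_on S X" "y \<in> S \<Longrightarrow> X differentiable (at y)" "y \<in> S \<Longrightarrow> fd \<pi> y (X y) = a"
    "y \<in> S \<Longrightarrow> hor_vec y (X y)"
  using assms smooth_on_imp_differentiable unfolding basic_def by blast+

lemma vertD:
  assumes "vert \<xi>"
  shows "smooth_on S \<xi>" "y \<in> S \<Longrightarrow> \<xi> differentiable (at y)" "y \<in> S \<Longrightarrow> fd \<pi> y (\<xi> y) = 0"
  using assms smooth_on_imp_differentiable unfolding vert_def by blast+

text \<open>Both fields are \<pi>-related to constant fields on the base, which commute. Requiring
  basic fields to project to constants thus makes all brackets among basic and vertical fields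
  vertical; vertical fields are the case of the constant 0.\<close>

lemma fd_\<pi>_bracket:
  assumes x: "x \<in> S" and d: "X differentiable (at x)" "Y differentiable (at x)"
    and X: "\<And>y. y \<in> S \<Longrightarrow> fd \<pi> y (X y) = a" and Y: "\<And>y. y \<in> S \<Longrightarrow> fd \<pi> y (Y y) = b"
  shows "fd \<pi> x (lie_bracket X Y x) = 0"
proof -
  note dd = smooth_on_imp_differentiable[OF smooth_on_fd[OF smooth_\<pi>] x]
  have *: "fd (\<lambda>y. fd \<pi> y (Z x)) x v + fd \<pi> x (fd Z x v) = 0"
    if Z: "Z differentiable (at x)" "\<And>y. y \<in> S \<Longrightarrow> fd \<pi> y (Z y) = c" for Z c v
  proof -
    have "fd (\<lambda>y. fd \<pi> y (Z y)) x = fd (\<lambda>y. c) x" by (rule fd_cong[OF open_S x Z(2)])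
    then show ?thesis using fd_family(1)[OF open_S x linear_\<pi> dd Z(1), where v=v] by simp
  qed
  have "fd (\<lambda>y. fd \<pi> y (Y x)) x (X x) = fd (\<lambda>y. fd \<pi> y (X x)) x (Y x)"
    by (rule fd_symmetric[OF open_S x smooth_onD[OF smooth_\<pi>]])
  then show ?thesis
    using *[OF d(1) X, of "Y x"] *[OF d(2) Y, of "X x"]
    by (simp add: lie_bracket_def linear_diff[OF linear_\<pi>[OF x]]) (metis add_left_imp_eq)
qed

lemma G_hor_vert: "hor_vec y u \<Longrightarrow> fd \<pi> y v = 0 \<Longrightarrow> G y u v = 0"
  by (simp add: hor_vec_def)

lemma G_vert_hor: "y \<in> S \<Longrightarrow> hor_vec y u \<Longrightarrow> fd \<pi> y v = 0 \<Longrightarrow> G y v u = 0"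
  by (simp add: hor_vec_def sym_G[of y v])

lemma fd_zero: "x \<in> S \<Longrightarrow> (\<And>y. y \<in> S \<Longrightarrow> F y = c) \<Longrightarrow> fd F x v = 0"
  using fd_cong[OF open_S, of x F "\<lambda>_. c"] by simp

text \<open>In the Koszul formula, G (X, X) is constant along the fibres, G (X, \<eta>) vanishes
  identically and [X, \<eta>] is vertical.\<close>

lemma nabla_basic_basic:
  assumes X: "basic a X" and \<eta>: "vert \<eta>" and x: "x \<in> S"
  shows "G x (levi_civita G X X x) (\<eta> x) = 0"
proof -
  have Q: "a \<in> Q" using basicD(3)[OF X x] fd_\<pi>_in_Q[OF x] by metis
  have "fd (\<lambda>y. G y (X y) (X y)) x = fd (\<lambda>y. h (\<pi> y) a a) x"
    by (rule fd_cong[OF open_S x]) (simp add: basicD[OF X] flip: isometric)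
  moreover have "fd (\<lambda>y. G y (X y) (\<eta> y)) x (X x) = 0"
    by (rule fd_zero[OF x]) (simp add: G_hor_vert basicD[OF X] vertD[OF \<eta>])
  moreover have "G x (X x) (lie_bracket X \<eta> x) = 0"
    by (intro G_hor_vert basicD(4)[OF X x] fd_\<pi>_bracket[OF x basicD(2)[OF X x] vertD(2)[OF \<eta> x]
        basicD(3)[OF X] vertD(3)[OF \<eta>]])
  moreover have "lie_bracket X X x = 0" by (simp add: lie_bracket_def)
  ultimately show ?thesis
    using koszul[OF x basicD(2)[OF X x] basicD(2)[OF X x] vertD(2)[OF \<eta> x]]
      fd_h_vertical[OF x vertD(3)[OF \<eta> x] Q Q]
    by (simp add: linear_0[OF linear_G(1)[OF x]] sym_G[OF x, of _ "X x"])
qed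

text \<open>Constancy of G (X, Y) along the fibres and verticality of the brackets with \<xi> leave
  only [X, Y] in the Koszul formula, whose vertical part is twice the O'Neill tensor.\<close>

lemma nabla_vert_basic_hor:
  assumes X: "basic a X" and Y: "basic b Y" and \<xi>: "vert \<xi>" and x: "x \<in> S"
  shows "2 * G x (levi_civita G \<xi> X x) (Y x) = - G x (lie_bracket X Y x) (\<xi> x)"
proof -
  have Q: "a \<in> Q" "b \<in> Q" using basicD(3)[OF X x] basicD(3)[OF Y x] fd_\<pi>_in_Q[OF x] by metis+
  have "fd (\<lambda>y. G y (X y) (Y y)) x = fd (\<lambda>y. h (\<pi> y) a b) x"
    by (rule fd_cong[OF open_S x]) (simp add: basicD[OF X] basicD[OF Y] flip: isometric)
  then have "fd (\<lambda>y. G y (X y) (Y y)) x (\<xi> x) = 0"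
    using fd_h_vertical[OF x vertD(3)[OF \<xi> x] Q] by simp
  moreover have "fd (\<lambda>y. G y (\<xi> y) (Y y)) x (X x) = 0" "fd (\<lambda>y. G y (\<xi> y) (X y)) x (Y x) = 0"
    by (rule fd_zero[OF x]; simp add: G_vert_hor basicD[OF X] basicD[OF Y] vertD[OF \<xi>])+
  moreover have "G x (lie_bracket \<xi> X x) (Y x) = 0"
    by (intro G_vert_hor x basicD(4)[OF Y x] fd_\<pi>_bracket[OF x vertD(2)[OF \<xi> x] basicD(2)[OF X x]
        vertD(3)[OF \<xi>] basicD(3)[OF X]])
  moreover have "G x (lie_bracket \<xi> Y x) (X x) = 0"
    by (intro G_vert_hor x basicD(4)[OF X x] fd_\<pi>_bracket[OF x vertD(2)[OF \<xi> x] basicD(2)[OF Y x]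
        vertD(3)[OF \<xi>] basicD(3)[OF Y]])
  ultimately show ?thesis
    using koszul[OF x vertD(2)[OF \<xi> x] basicD(2)[OF X x] basicD(2)[OF Y x]] by simp
qed

text \<open>The right-hand side is left unsimplified on purpose: it involves the metric only on
  vertical vectors, so the versions for two metrics that are proportional there can be
  compared.\<close>

lemma nabla_vert_basic_vert:
  assumes X: "basic a X" and \<xi>: "vert \<xi>" and \<eta>: "vert \<eta>" and x: "x \<in> S"
  shows "2 * G x (levi_civita G \<xi> X x) (\<eta> x) = fd (\<lambda>y. G y (\<xi> y) (\<eta> y)) x (X x)
    + G x (lie_bracket \<xi> X x) (\<eta> x) - G x (lie_bracket X \<eta> x) (\<xi> x)"
proof -
  have "fd (\<lambda>y. G y (X y) (\<eta> y)) x (\<xi> x) = 0" "fd (\<lambda>y. G y (\<xi> y) (X y)) x (\<eta> x) = 0"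
    by (rule fd_zero[OF x]; simp add: G_vert_hor G_hor_vert basicD[OF X] vertD[OF \<xi>] vertD[OF \<eta>])+
  moreover have "G x (lie_bracket \<xi> \<eta> x) (X x) = 0"
    by (intro G_vert_hor x basicD(4)[OF X x] fd_\<pi>_bracket[OF x vertD(2)[OF \<xi> x] vertD(2)[OF \<eta> x]
        vertD(3)[OF \<xi>] vertD(3)[OF \<eta>]])
  ultimately show ?thesis
    using koszul[OF x vertD(2)[OF \<xi> x] basicD(2)[OF X x] vertD(2)[OF \<eta> x]] by simp
qed

text \<open>Differentiate G (X, \<eta>) = 0 along \<xi>. The right-hand side is the second
  fundamental form of the fibres.\<close>

lemma nabla_vert_vert:
  assumes X: "basic a X" and \<xi>: "vert \<xi>" and \<eta>: "vert \<eta>" and x: "x \<in> S"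
  shows "G x (levi_civita G \<xi> X x) (\<eta> x) = - G x (X x) (levi_civita G \<xi> \<eta> x)"
proof -
  have "fd (\<lambda>y. G y (X y) (\<eta> y)) x (\<xi> x) = 0"
    by (rule fd_zero[OF x]) (simp add: G_hor_vert basicD[OF X] vertD[OF \<eta>])
  then show ?thesis
    using metric_compatible[OF x basicD(2)[OF X x] vertD(2)[OF \<eta> x], of \<xi>] by simp
qed

end

section \<open>Rescaling the fibres\<close>

text \<open>Along the line x + t u, a negative second derivative would make the first derivative,
  zero at x, negative just to the right of t = 0; the mean value theorem would then give a value
  below the minimum.\<close>

lemma fd_minimum:
  fixes F :: "'a::euclidean_space \<Rightarrow> real"
  assumes S: "open S" "x \<in> S" and F: "ck_on (Suc (Suc 0)) S F" and min: "\<And>y. y \<in> S \<Longrightarrow> F x \<le> F y"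
  shows "fd F x v = 0" "0 \<le> fd (\<lambda>y. fd F y u) x u"
proof -
  have d: "F differentiable (at y)" "(\<lambda>y. fd F y u) differentiable (at y)" if "y \<in> S" for y
    using F that by auto
  have zero: "fd F x = (\<lambda>v. 0)"
    by (rule differential_zero_maxmin[OF S(2,1) has_derivative_fd[OF d(1)[OF S(2)]]])
      (use min in auto)
  then show "fd F x v = 0" by simp
  show "0 \<le> fd (\<lambda>y. fd F y u) x u"
  proof (rule ccontr)
    assume neg: "\<not> 0 \<le> fd (\<lambda>y. fd F y u) x u"
    define l where "l t = x + t *\<^sub>R u" for t :: real
    have dl: "(l has_derivative (\<lambda>h. h *\<^sub>R u)) (at t)" for t
      unfolding l_def[abs_def] by (auto intro!: derivative_eq_intros)
    have l0: "l 0 = x" by (simp add: l_def)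
    have "open (l -` S)"
      by (rule open_vimage[OF S(1)]) (auto simp: l_def[abs_def] intro!: continuous_intros)
    moreover have "0 \<in> l -` S" using S(2) l0 by simp
    ultimately obtain e where e0: "e > 0" "ball 0 e \<subseteq> l -` S" by (rule openE)
    have e: "l t \<in> S" if "\<bar>t\<bar> < e" for t
      using subsetD[OF e0(2), of t] that by (simp add: dist_real_def)
    have "((\<lambda>t. fd F (l t) u) has_derivative (\<lambda>h. fd (\<lambda>y. fd F y u) (l 0) (h *\<^sub>R u))) (at 0)"
      by (rule has_derivative_compose[OF dl has_derivative_fd[OF d(2)]]) (simp add: S(2) l0)
    then have "((\<lambda>t. fd F (l t) u) has_real_derivative fd (\<lambda>y. fd F y u) x u) (at 0)"
      by (simp add: has_field_derivative_def linear_scale[OF linear_fd[OF d(2)[OF S(2)]]] l0 mult_commute_abs)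
    from DERIV_neg_dec_right[OF this] neg
    obtain \<delta> where \<delta>: "\<delta> > 0" "\<And>t. 0 < t \<Longrightarrow> t < \<delta> \<Longrightarrow> fd F (l t) u < fd F (l 0) u"
      by auto
    define t where "t = min \<delta> e / 2"
    have t: "0 < t" "t < \<delta>" "t < e" using \<delta>(1) e0(1) by (auto simp: t_def)
    have der: "((\<lambda>t. F (l t)) has_real_derivative fd F (l s) u) (at s)" if "\<bar>s\<bar> < e" for s
      using has_derivative_compose[OF dl has_derivative_fd[OF d(1)[OF e[OF that]]]]
      by (simp add: has_field_derivative_def linear_scale[OF linear_fd[OF d(1)[OF e[OF that]]]] mult_commute_abs)
    obtain s where s: "0 < s" "s < t" "F (l t) - F (l 0) = (t - 0) * fd F (l s) u"
      using MVT2[OF t(1) der] t by auto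
    have n: "fd F (l s) u < 0" using \<delta>(2)[of s] s t zero by (simp add: l0)
    have "F (l t) < F x" using s(3) mult_pos_neg[OF t(1) n] by (simp add: l0)
    then show False using min[OF e[of t]] t by simp
  qed
qed

section \<open>The O'Neill tensor of a submersion\<close>

context submersion_metric
begin

lemma linear_hor: "x \<in> S \<Longrightarrow> linear (\<lambda>u. hor u x)"
  using linear_lift by (simp add: hor_def)

lemma linear_ver: "x \<in> S \<Longrightarrow> linear (\<lambda>u. ver u x)"
  unfolding ver_def by (rule linear_compose_sub[OF linear_ident linear_hor])

text \<open>Differentiating G (Z, \<open>ver w\<close>) = 0 expresses the product of w with a
  derivative of a horizontal field Z through the value of Z at x alone. It is needed because the
  O'Neill tensor is defined by projected constant fields, while the curvature is computed with basic
  ones.\<close>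

lemma bracket_tensorial:
  assumes x: "x \<in> S" and w: "fd \<pi> x w = 0"
    and d: "X differentiable (at x)" "Y differentiable (at x)" "X' differentiable (at x)" "Y' differentiable (at x)"
    and h: "\<And>y. y \<in> S \<Longrightarrow> hor_vec y (X y)" "\<And>y. y \<in> S \<Longrightarrow> hor_vec y (Y y)"
      "\<And>y. y \<in> S \<Longrightarrow> hor_vec y (X' y)" "\<And>y. y \<in> S \<Longrightarrow> hor_vec y (Y' y)"
    and eq: "X x = X' x" "Y x = Y' x"
  shows "G x (lie_bracket X Y x) w = G x (lie_bracket X' Y' x) w"
proof -
  have *: "G x (fd Z x v) w = - fd (\<lambda>y. G y (Z x) w) x v - G x (Z x) (fd (ver w) x v)"
    if Z: "Z differentiable (at x)" "\<And>y. y \<in> S \<Longrightarrow> hor_vec y (Z y)" for Z v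
  proof -
    have "fd (\<lambda>y. G y (Z y) (ver w y)) x v = 0"
      by (rule fd_zero[OF x]) (simp add: G_hor_vert Z fd_\<pi>_ver)
    then show ?thesis
      using fd_G[OF x Z(1) vertD(2)[OF vert_ver x], of w v] by (simp add: ver_eq[OF x w])
  qed
  show ?thesis
    unfolding lie_bracket_def linear_diff[OF linear_G(1)[OF x]]
    by (simp add: *[OF d(1) h(1)] *[OF d(2) h(2)] *[OF d(3) h(3)] *[OF d(4) h(4)] eq)
qed

lemma G_oneill:
  assumes x: "x \<in> S" and V: "\<And>y. y \<in> S \<Longrightarrow> V y = {u. fd \<pi> y u = 0}" and w: "fd \<pi> x w = 0"
  shows "G x w (oneill G V x u v) = G x w (lie_bracket (hor u) (hor v) x) / 2"
proof -
  have hp: "hpart G V y u = hor u y" if "y \<in> S" for y u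
    by (rule vpart_eq(2)[where V=V, OF that]) (rule V[OF that])
  have "lie_bracket (\<lambda>y. hpart G V y u) (\<lambda>y. hpart G V y v) x = lie_bracket (hor u) (hor v) x"
    unfolding lie_bracket_def
    using fd_cong[OF open_S x hp] by (simp add: hp[OF x])
  then have "oneill G V x u v = (1/2) *\<^sub>R ver (lie_bracket (hor u) (hor v) x) x"
    using vpart_eq(1)[where V=V, OF x] V[OF x] by (simp add: oneill_def)
  moreover have "G x w (hor z x) = 0" for z
    by (rule G_vert_hor[OF x hor_vec_hor[OF x] w])
  ultimately show ?thesis
    by (simp add: ver_def linear_scale[OF linear_G(2)[OF x]] linear_diff[OF linear_G(2)[OF x]])
qed

text \<open>The adjoint is a definite description, so its vanishing carries information only once
  existence and uniqueness are known. The functional is linear in v because \<open>hor v\<close> is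
  linear in v at every point, hence so are its derivatives; the horizontal part of its Riesz vector
  is the unique candidate.\<close>

lemma oneill_adjoint_eq_0D:
  assumes x: "x \<in> S" and V: "\<And>y. y \<in> S \<Longrightarrow> V y = {u. fd \<pi> y u = 0}" and w: "fd \<pi> x w = 0"
    and zero: "oneill_adjoint G V x u w = 0" and v: "hor_vec x v"
  shows "G x w (lie_bracket (hor u) (hor v) x) = 0"
proof -
  let ?\<kappa> = "\<lambda>v. G x w (oneill G V x u v)"
  have H: "horizontal G V x = {u. hor_vec x u}" by (auto simp: horizontal_def hor_vec_def V x)
  have dh: "hor a differentiable (at x)" for a
    by (rule smooth_on_imp_differentiable[OF smooth_hor x])
  have "linear (\<lambda>v. G x w ((1/2) *\<^sub>R (fd (hor v) x (hor u x) - fd (hor u) x (hor v x))))"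
  proof (rule linear_compose[OF _ linear_G(2)[OF x], unfolded o_def])
    have "linear (\<lambda>v. fd (hor u) x (hor v x))"
      using linear_compose[OF linear_hor[OF x] linear_fd[OF dh]] by (simp add: o_def)
    moreover have "linear (\<lambda>v. fd (hor v) x (hor u x))"
      by (rule linear_fd_family[where M="\<lambda>y v. hor v y", OF open_S x linear_hor dh])
    ultimately show "linear (\<lambda>v. (1/2) *\<^sub>R (fd (hor v) x (hor u x) - fd (hor u) x (hor v x)))"
      by (intro linear_compose_scale_right linear_compose_sub)
  qed
  then have l: "linear ?\<kappa>"
    by (simp add: G_oneill[OF x V w] lie_bracket_def linear_scale[OF linear_G(2)[OF x]])
  obtain z where z: "\<And>v. G x z v = ?\<kappa> v" using riesz[OF ip[OF x] l] by blast
  have "\<exists>!z. z \<in> horizontal G V x \<and> (\<forall>v\<in>horizontal G V x. G x z v = ?\<kappa> v)"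
  proof (rule ex1I[of _ "hor z x"])
    have "G x (hor z x) v = G x z v" if "hor_vec x v" for v
      using G_vert_hor[OF x that fd_\<pi>_ver[OF x, of z]] by (simp add: ver_def linear_diff[OF linear_G(1)[OF x]])
    then show "hor z x \<in> horizontal G V x \<and> (\<forall>v\<in>horizontal G V x. G x (hor z x) v = ?\<kappa> v)"
      by (simp add: H hor_vec_hor x z)
    then have *: "\<And>v. hor_vec x v \<Longrightarrow> G x (hor z x) v = ?\<kappa> v" by (simp add: H)
    fix z' assume z': "z' \<in> horizontal G V x \<and> (\<forall>v\<in>horizontal G V x. G x z' v = ?\<kappa> v)"
    let ?e = "z' - hor z x"
    have "hor_vec x ?e"
      using z' hor_vec_hor[OF x, of z] by (simp add: H hor_vec_def linear_diff[OF linear_G(1)[OF x]])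
    then have "G x ?e ?e = 0"
      using z' * by (simp add: H linear_diff[OF linear_G(1)[OF x], of _ _ ?e])
    then show "z' = hor z x" using inner_product_onD(4)[OF ip[OF x], of ?e] by (cases "?e = 0") auto
  qed
  from theI'[OF this] have "\<forall>v\<in>horizontal G V x. G x (oneill_adjoint G V x u w) v = ?\<kappa> v"
    unfolding oneill_adjoint_def by simp
  then have "?\<kappa> v = 0" using v by (simp add: H zero linear_0[OF linear_G(1)[OF x]])
  then show ?thesis by (simp add: G_oneill[OF x V w])
qed

end

section \<open>Rescaling by a positive function along the fibres of a submersion\<close>

locale warped_submersion = submersion_metric S G Q h \<pi>
  for S :: "'a::euclidean_space set" and G :: "'a local_metric" and Q h \<pi> +
  fixes f :: "'a \<Rightarrow> real" and G' :: "'a local_metric"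
  assumes smooth_f: "smooth_on S f" and f_pos: "y \<in> S \<Longrightarrow> 0 < f y"
    and G'_def: "y \<in> S \<Longrightarrow> G' y u v = G y (hor u y) (hor v y) + f y * G y (ver u y) (ver v y)"
begin

text \<open>The form free of projections: f multiplies the part of \<open>G\<close> not pulled back
  from the base. Smoothness of \<open>G'\<close> is read off from it.\<close>

lemma G'_eq:
  assumes y: "y \<in> S"
  shows "G' y u v = h (\<pi> y) (fd \<pi> y u) (fd \<pi> y v)
    + f y * (G y u v - h (\<pi> y) (fd \<pi> y u) (fd \<pi> y v))"
proof -
  have "G y (hor u y) (hor v y) = h (\<pi> y) (fd \<pi> y u) (fd \<pi> y v)"
    by (simp add: G_hor y fd_\<pi>_hor)
  moreover have "G y u (hor v y) = h (\<pi> y) (fd \<pi> y u) (fd \<pi> y v)"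
    using y by (simp add: sym_G[OF y, of u] G_hor inner_product_onD(1)[OF ip_h, of y "fd \<pi> y v"])
  moreover have "G y (hor u y) v = h (\<pi> y) (fd \<pi> y u) (fd \<pi> y v)"
    by (simp add: G_hor y)
  ultimately have "G y (ver u y) (ver v y) = G y u v - h (\<pi> y) (fd \<pi> y u) (fd \<pi> y v)"
    by (simp add: ver_def linear_diff[OF linear_G(1)[OF y]] linear_diff[OF linear_G(2)[OF y]])
  then show ?thesis
    using \<open>G y (hor u y) (hor v y) = _\<close> by (simp add: G'_def[OF y])
qed

lemma G'_vert:
  assumes y: "y \<in> S" and v: "fd \<pi> y v = 0"
  shows "G' y u v = f y * G y u v"
  by (simp add: G'_eq y v h_zero)

lemma local_riemannian_metric_G': "local_riemannian_metric S G'"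
  unfolding local_riemannian_metric_def
proof (intro conjI ballI allI)
  fix y assume y: "y \<in> S"
  note l = linear_hor[OF y] linear_ver[OF y] linear_G[OF y]
  have "0 < G' y u u" if "u \<noteq> 0" for u
  proof -
    have "0 < G y (hor u y) (hor u y)" if "hor u y \<noteq> 0"
      using inner_product_onD(4)[OF ip[OF y]] that by auto
    moreover have "0 < G y (ver u y) (ver u y)" if "ver u y \<noteq> 0"
      using inner_product_onD(4)[OF ip[OF y]] that by auto
    moreover have "hor u y \<noteq> 0 \<or> ver u y \<noteq> 0" using that hor_add_ver[of u y] by auto
    ultimately show ?thesis
      using f_pos[OF y] linear_0[OF linear_G(1)[OF y]]
      by (cases "hor u y = 0"; cases "ver u y = 0") (simp_all add: G'_def[OF y] add_pos_pos)
  qed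
  moreover have "G' y u v = G' y v u" for u v
    by (simp add: G'_def[OF y] sym_G[OF y, of "hor u y" "hor v y"] sym_G[OF y, of "ver u y" "ver v y"])
  moreover have "G' y (u + v) w = G' y u w + G' y v w" for u v w
    by (simp add: G'_def[OF y] linear_add[OF l(1)] linear_add[OF l(2)] linear_add[OF l(3)] distrib_left)
  moreover have "G' y (r *\<^sub>R u) v = r * G' y u v" for r u v
    by (simp add: G'_def[OF y] linear_scale[OF l(1)] linear_scale[OF l(2)] linear_scale[OF l(3)] distrib_left)
  ultimately show "inner_product_on UNIV (G' y)" unfolding inner_product_on_def by simp
next
  fix u v
  have s: "ck_on k S (\<lambda>y. h (\<pi> y) (fd \<pi> y u) (fd \<pi> y v))" for k
    by (rule smooth_onD[OF smooth_h_fields[OF smooth_on_fd[OF smooth_\<pi>] smooth_on_fd[OF smooth_\<pi>]]]) simp_all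
  show "smooth_on S (\<lambda>y. G' y u v)"
    by (subst smooth_on_cong[OF open_S G'_eq], assumption, rule smooth_onI)
      (intro ck_on_add[OF open_S] ck_on_mult[OF open_S] ck_on_diff[OF open_S] s smooth_onD[OF smooth_f]
        smooth_onD[OF smooth_G])
qed

lemma hor_vec_G':
  assumes "y \<in> S"
  shows "(\<forall>v. fd \<pi> y v = 0 \<longrightarrow> G' y u v = 0) \<longleftrightarrow> hor_vec y u"
  using f_pos[OF assms] by (auto simp: hor_vec_def G'_vert assms)

text \<open>Rescaling the fibres changes neither the horizontal spaces nor the metric on them, so
  the same \<open>h\<close> serves as base metric. All formulas for submersions thereby hold for
  \<open>G\<close> and \<open>G'\<close> with the same basic and vertical fields.\<close>

lemma riemannian_submersion_G': "riemannian_submersion S G' Q h \<pi>"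
  unfolding riemannian_submersion_def Let_def
proof (intro conjI ballI)
  fix y u v assume y: "y \<in> S"
    and "u \<in> horizontal G' (\<lambda>_. {w. fd \<pi> y w = 0}) y" "v \<in> horizontal G' (\<lambda>_. {w. fd \<pi> y w = 0}) y"
  then have hv: "hor_vec y u" "hor_vec y v" by (simp_all add: horizontal_def hor_vec_G'[symmetric])
  then have "ver u y = 0" using y by (simp add: ver_def hor_eq)
  then show "h (\<pi> y) (fd \<pi> y u) (fd \<pi> y v) = G' y u v"
    using hv y by (simp add: G'_def hor_eq isometric linear_0[OF linear_G(1)])
qed (use smooth_\<pi> \<pi>_in_Q range_\<pi> ip_h smooth_h in auto)

sublocale W: submersion_metric S G' Q h \<pi>
  by unfold_locales (rule open_S local_riemannian_metric_G' Q riemannian_submersion_G')+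

lemma W_hor_vec: "y \<in> S \<Longrightarrow> W.hor_vec y u \<longleftrightarrow> hor_vec y u"
  unfolding W.hor_vec_def by (rule hor_vec_G')

lemma W_basic: "W.basic a X \<longleftrightarrow> basic a X"
  by (simp add: W.basic_def basic_def W_hor_vec)

text \<open>Brackets do not depend on the metric, so in \<open>nabla_vert_basic_vert\<close> every
  term is multiplied by f, except that X also differentiates f. The multiple of f that this leaves
  is zero by \<open>nabla_vert_vert\<close>, since \<open>\<nabla>\<^sub>\<xi> \<eta>\<close> is
  vertical.\<close>

lemma nabla_warped:
  assumes X: "basic a X" and \<xi>: "vert \<xi>" and \<eta>: "vert \<eta>" and y: "y \<in> S"
    and tg: "fd \<pi> y (levi_civita G \<xi> \<eta> y) = 0"
  shows "2 * G' y (levi_civita G' \<xi> X y) (\<eta> y) = fd f y (X y) * G y (\<xi> y) (\<eta> y)"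
proof -
  have df: "f differentiable (at y)" by (rule smooth_on_imp_differentiable[OF smooth_f y])
  have dG: "(\<lambda>y. G y (\<xi> y) (\<eta> y)) differentiable (at y)"
    by (rule fd_family2(2)[OF open_S y linear_G diff_G[OF y] vertD(2)[OF \<xi> y] vertD(2)[OF \<eta> y]])
  have "fd (\<lambda>y. G' y (\<xi> y) (\<eta> y)) y = fd (\<lambda>y. f y * G y (\<xi> y) (\<eta> y)) y"
    by (rule fd_cong[OF open_S y]) (simp add: G'_vert vertD[OF \<eta>])
  then have "fd (\<lambda>y. G' y (\<xi> y) (\<eta> y)) y (X y)
      = f y * fd (\<lambda>y. G y (\<xi> y) (\<eta> y)) y (X y) + fd f y (X y) * G y (\<xi> y) (\<eta> y)"
    by (simp add: fd_bilinear(1)[OF bounded_bilinear_mult df dG])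
  then have "2 * G' y (levi_civita G' \<xi> X y) (\<eta> y)
      = fd f y (X y) * G y (\<xi> y) (\<eta> y) + f y * (2 * G y (levi_civita G \<xi> X y) (\<eta> y))"
    unfolding W.nabla_vert_basic_vert[OF X[folded W_basic] \<xi> \<eta> y] nabla_vert_basic_vert[OF X \<xi> \<eta> y]
    by (simp add: G'_vert y vertD[OF \<xi>] vertD[OF \<eta>] algebra_simps)
  moreover have "G y (levi_civita G \<xi> X y) (\<eta> y) = 0"
    unfolding nabla_vert_vert[OF X \<xi> \<eta> y] using G_hor_vert[OF basicD(4)[OF X y] tg] by simp
  ultimately show ?thesis by simp
qed

text \<open>With \<open>X\<close> the basic field through \<open>u\<close> and \<open>\<xi>\<close> the vertical projection of \<open>w\<close>, all terms of
  \<open>R(\<xi>, X, X, \<xi>)\<close> vanish at a critical point of \<open>f\<close> where \<open>A\<^sup>*\<^sub>u w = 0\<close>, except for the one that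
  contains the Hessian of \<open>f\<close>.\<close>

lemma warped_curvature_nonpos:
  assumes x: "x \<in> S"
    and tg: "\<And>\<xi> \<eta> y. vert \<xi> \<Longrightarrow> vert \<eta> \<Longrightarrow> y \<in> S \<Longrightarrow> fd \<pi> y (levi_civita G \<xi> \<eta> y) = 0"
    and w: "fd \<pi> x w = 0" and u: "hor_vec x u"
    and A: "\<And>v. hor_vec x v \<Longrightarrow> G x w (lie_bracket (hor u) (hor v) x) = 0"
    and crit: "\<And>v. fd f x v = 0" and hess: "0 \<le> fd (\<lambda>y. fd f y u) x u"
  shows "G' x (curvature G' x w u u) w \<le> 0"
proof -
  define a where "a = fd \<pi> x u"
  define X where "X = lift a"
  define \<xi> where "\<xi> = ver w"
  let ?N = "levi_civita G'"
  have X: "basic a X" unfolding X_def by (rule basic_lift) (simp add: a_def x)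
  have \<xi>: "vert \<xi>" unfolding \<xi>_def by (rule vert_ver)
  have Xx: "X x = u" by (simp add: X_def a_def lift_fd_\<pi> x u)
  have \<xi>x: "\<xi> x = w" by (simp add: \<xi>_def ver_eq x w)
  note XW = X[folded W_basic] and sX = basicD(1)[OF X] and s\<xi> = vertD(1)[OF \<xi>]
  note star = nabla_warped[OF X _ _ _ tg]
  have split: "G' x z v = G' x z (hor v x) + G' x z (ver v x)" for z v
    using linear_add[OF W.linear_G(2)[OF x], of z "hor v x" "ver v x"] by (simp add: hor_add_ver)
  \<comment> \<open>The hypothesis \<open>A\<close> speaks of projected constant fields and the
    Koszul computation of basic fields through the same vectors; \<open>bracket_tensorial\<close>
    reconciles them.\<close>
  have hor0: "G' x (?N \<xi> X x) v = 0" if "hor_vec x v" for v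
  proof -
    let ?Y = "lift (fd \<pi> x v)"
    have Y: "basic (fd \<pi> x v) ?Y" "?Y x = v"
      by (simp_all add: basic_lift x lift_fd_\<pi> that)
    have "G x (lie_bracket X ?Y x) w = G x (lie_bracket (hor u) (hor v) x) w"
      by (rule bracket_tensorial[OF x w basicD(2)[OF X x] basicD(2)[OF Y(1) x]
            smooth_on_imp_differentiable[OF smooth_hor x] smooth_on_imp_differentiable[OF smooth_hor x]
            basicD(4)[OF X] basicD(4)[OF Y(1)] hor_vec_hor hor_vec_hor])
        (simp_all add: Xx Y(2) hor_eq x u that)
    then have "G' x (lie_bracket X ?Y x) (\<xi> x) = 0"
      using A[OF that] by (simp add: \<xi>x G'_vert x w sym_G[OF x, of _ w])
    then show ?thesis
      using W.nabla_vert_basic_hor[OF XW Y(1)[folded W_basic] \<xi> x] by (simp add: Y(2))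
  qed
  \<comment> \<open>Stated for every vertical \<zeta>, as it is needed for \<xi> and, in
    \<open>t3\<close>, for a vertical extension of [\<xi>, X].\<close>
  have vert0: "G' x (?N \<zeta> X x) v = 0" if "vert \<zeta>" "fd \<pi> x v = 0" for \<zeta> v
    using star[OF that(1) vert_ver x that(1) vert_ver x, of v] by (simp add: ver_eq x that crit)
  have N\<xi>X: "?N \<xi> X x = 0"
  proof (rule W.eq_G[OF x])
    fix z
    show "G' x (?N \<xi> X x) z = G' x 0 z"
      using split[of _ z] hor0[OF hor_vec_hor[OF x]] vert0[OF \<xi> fd_\<pi>_ver[OF x]]
      by (simp add: linear_0[OF W.linear_G(1)[OF x]])
  qed
  have NXX: "W.hor_vec x (?N X X x)"
    unfolding W.hor_vec_def
    using W.nabla_basic_basic[OF XW vert_ver x] by (metis ver_eq[OF x])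
  \<comment> \<open>Differentiating \<open>G' (\<nabla>\<^sub>X X, \<xi>) = 0\<close> along \<xi>
    leaves \<open>- G' (\<nabla>\<^sub>X X, \<nabla>\<^sub>\<xi> \<xi>)\<close>. Here
    \<open>\<nabla>\<^sub>X X\<close> enters only by its horizontal value at x, so a basic field Y
    through it can replace it; \<open>G' (\<nabla>\<^sub>\<xi> Y, \<xi>)\<close> then has the factor
    Y f, which is 0 at x.\<close>
  have t1: "G' x (?N \<xi> (?N X X) x) w = 0"
  proof -
    have "fd (\<lambda>y. G' y (?N X X y) (\<xi> y)) x (\<xi> x) = 0"
      by (rule fd_zero[OF x]) (rule W.nabla_basic_basic[OF XW \<xi>])
    then have "G' x (?N \<xi> (?N X X) x) w = - G' x (?N X X x) (?N \<xi> \<xi> x)"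
      using W.metric_compatible[OF x smooth_on_imp_differentiable[OF W.smooth_levi_civita[OF sX sX] x]
          vertD(2)[OF \<xi> x], of \<xi>] by (simp add: \<xi>x)
    moreover
    let ?Y = "W.lift (fd \<pi> x (?N X X x))"
    have Y: "W.basic (fd \<pi> x (?N X X x)) ?Y" "?Y x = ?N X X x"
      by (simp_all add: W.basic_lift x W.lift_fd_\<pi> NXX)
    have "G' x (?Y x) (?N \<xi> \<xi> x) = - G' x (?N \<xi> ?Y x) (\<xi> x)"
      using W.nabla_vert_vert[OF Y(1) \<xi> \<xi> x] by simp
    moreover have "2 * G' x (?N \<xi> ?Y x) (\<xi> x) = 0"
      by (subst nabla_warped[OF Y(1)[unfolded W_basic] \<xi> \<xi> x tg[OF \<xi> \<xi> x]]) (simp add: crit)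
    ultimately show ?thesis by (simp add: Y(2))
  qed
  \<comment> \<open>As \<open>\<nabla>\<^sub>\<xi> X\<close> vanishes at x, metric compatibility
    makes the term the u-derivative of \<open>G' (\<nabla>\<^sub>\<xi> X, \<xi>)\<close>, which near
    x is half of (X f) G (\<xi>, \<xi>). At a critical point only the derivative of X f
    survives.\<close>
  have t2: "2 * G' x (?N X (?N \<xi> X) x) w = fd (\<lambda>y. fd f y u) x u * G x w w"
  proof -
    have dN: "?N \<xi> X differentiable (at x)"
      by (rule smooth_on_imp_differentiable[OF W.smooth_levi_civita[OF s\<xi> sX] x])
    have "G' x (?N X (?N \<xi> X) x) w = fd (\<lambda>y. G' y (?N \<xi> X y) (\<xi> y)) x u"
      using W.metric_compatible[OF x dN vertD(2)[OF \<xi> x], of X]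
      by (simp add: \<xi>x Xx N\<xi>X linear_0[OF W.linear_G(1)[OF x]])
    also have "\<dots> = fd (\<lambda>y. (1/2) * (fd f y (X y) * G y (\<xi> y) (\<xi> y))) x u"
    proof (subst fd_cong[OF open_S x])
      show "G' y (?N \<xi> X y) (\<xi> y) = (1/2) * (fd f y (X y) * G y (\<xi> y) (\<xi> y))" if "y \<in> S" for y
        using star[OF \<xi> \<xi> that \<xi> \<xi> that] by simp
    qed simp
    finally have "2 * G' x (?N X (?N \<xi> X) x) w = 2 * fd (\<lambda>y. (1/2) * (fd f y (X y) * G y (\<xi> y) (\<xi> y))) x u"
      by simp
    \<comment> \<open>The second identity is special to a critical point: in general df applied to
      the derivative of X is added.\<close>
    moreover have dfX: "(\<lambda>y. fd f y (X y)) differentiable (at x)"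
      "fd (\<lambda>y. fd f y (X y)) x u = fd (\<lambda>y. fd f y u) x u"
    proof -
      note fam = fd_family[where M="\<lambda>y. fd f y" and Y=X, OF open_S x
          linear_fd[OF smooth_on_imp_differentiable[OF smooth_f]]
          smooth_on_imp_differentiable[OF smooth_on_fd[OF smooth_f] x] basicD(2)[OF X x]]
      show "(\<lambda>y. fd f y (X y)) differentiable (at x)" by (rule fam(2))
      show "fd (\<lambda>y. fd f y (X y)) x u = fd (\<lambda>y. fd f y u) x u"
        using fam(1)[of u] by (simp add: crit Xx)
    qed
    have dG: "(\<lambda>y. G y (\<xi> y) (\<xi> y)) differentiable (at x)"
      by (rule fd_family2(2)[OF open_S x linear_G diff_G[OF x] vertD(2)[OF \<xi> x] vertD(2)[OF \<xi> x]])
    note b = fd_bilinear[OF bounded_bilinear_mult dfX(1) dG]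
    have "fd (\<lambda>y. (1/2) * (fd f y (X y) * G y (\<xi> y) (\<xi> y))) x u
        = (1/2) * fd (\<lambda>y. fd f y (X y) * G y (\<xi> y) (\<xi> y)) x u"
      by (rule fd_bounded_linear(1)[OF bounded_linear_mult_right b(2)])
    ultimately show ?thesis by (simp add: b(1) dfX(2) crit \<xi>x)
  qed
  \<comment> \<open>A connection depends on its first field only through the value at x, so the
    vertical vector [\<xi>, X] may be extended by projecting a constant field.\<close>
  have t3: "G' x (?N (lie_bracket \<xi> X) X x) w = 0"
  proof -
    let ?z = "lie_bracket \<xi> X x"
    have "fd \<pi> x ?z = 0"
      by (rule fd_\<pi>_bracket[OF x vertD(2)[OF \<xi> x] basicD(2)[OF X x] vertD(3)[OF \<xi>] basicD(3)[OF X]])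
    then have "?N (lie_bracket \<xi> X) X x = ?N (ver ?z) X x"
      by (simp add: levi_civita_def ver_eq x)
    then show ?thesis using vert0[OF vert_ver w] by simp
  qed
  have "0 \<le> G x w w"
    using inner_product_onD(4)[OF ip[OF x], of w w] linear_0[OF linear_G(1)[OF x]] by (cases "w = 0") auto
  then have "0 \<le> fd (\<lambda>y. fd f y u) x u * G x w w" using hess by simp
  moreover have "curvature G' x w u u = ?N \<xi> (?N X X) x - ?N X (?N \<xi> X) x - ?N (lie_bracket \<xi> X) X x"
    using W.curvature_fields[OF x s\<xi> sX sX] by (simp add: \<xi>x Xx)
  ultimately show ?thesis
    using t1 t2 t3 by (simp add: linear_diff[OF W.linear_G(1)[OF x]])
qed

end

section \<open>Charts and foliations\<close>

locale smooth_atlas =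
  fixes A :: "('m::t2_space, 'e::euclidean_space) chart set"
  assumes atlas: "smooth_structure A"
begin

lemma chart_homeomorphism:
  assumes "c \<in> A"
  obtains c' where "open (fst c)" "open (img c)" "homeomorphism (fst c) (img c) (snd c) c'"
  using atlas assms unfolding smooth_structure_def is_chart_def img_def by metis

lemma chart_inj: "c \<in> A \<Longrightarrow> inj_on (snd c) (fst c)"
  by (rule chart_homeomorphism) (auto intro: inj_on_inverseI homeomorphism_apply1)

lemma param_chart: "c \<in> A \<Longrightarrow> q \<in> fst c \<Longrightarrow> param c (snd c q) = q"
  unfolding param_def by (rule inv_into_f_f[OF chart_inj])

lemma chart_param: "y \<in> img c \<Longrightarrow> param c y \<in> fst c" "y \<in> img c \<Longrightarrow> snd c (param c y) = y"
  unfolding param_def img_def by (rule inv_into_into f_inv_into_f; assumption)+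

lemma overlap_iff: "c \<in> A \<Longrightarrow> y \<in> overlap c d \<longleftrightarrow> y \<in> img c \<and> param c y \<in> fst d"
  using param_chart[of c] chart_param[of y c] by (force simp: overlap_def img_def)

lemma overlap_subset_img: "c \<in> A \<Longrightarrow> overlap c d \<subseteq> img c"
  by (auto simp: overlap_iff)

lemma open_overlap:
  assumes "c \<in> A" "d \<in> A"
  shows "open (overlap c d)"
proof -
  obtain c' where c: "open (fst c)" "open (img c)" "homeomorphism (fst c) (img c) (snd c) c'"
    using chart_homeomorphism[OF assms(1)] .
  have "open (fst d)" by (rule chart_homeomorphism[OF assms(2)])
  then have "openin (top_of_set (fst c)) (fst c \<inter> fst d)" by (simp add: openin_open_Int)
  then have "openin (top_of_set (img c)) (overlap c d)"
    unfolding overlap_def by (rule homeomorphism_imp_open_map[OF c(3)])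
  then show ?thesis using c(2) openin_open_trans by blast
qed

lemma transition_point:
  assumes "c \<in> A" "d \<in> A" "y \<in> overlap c d"
  shows "param d (transition c d y) = param c y" "transition c d y \<in> overlap d c"
    "transition d c (transition c d y) = y" "transition c d y \<in> img d"
proof -
  have y: "y \<in> img c" "param c y \<in> fst d" using assms by (simp_all add: overlap_iff)
  show p: "param d (transition c d y) = param c y"
    by (simp add: transition_def param_chart assms(2) y(2))
  show i: "transition c d y \<in> img d" using y(2) by (simp add: transition_def img_def)
  show "transition c d y \<in> overlap d c" by (simp add: overlap_iff assms(2) i p chart_param y(1))
  show "transition d c (transition c d y) = y"
    using p by (simp add: transition_def[of d c] chart_param(2)[OF y(1)])
qed

lemma smooth_transition: "c \<in> A \<Longrightarrow> d \<in> A \<Longrightarrow> smooth_on (overlap c d) (transition c d)"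
  using atlas unfolding smooth_structure_def compatible_def by blast

lemmas diff_transition = smooth_on_imp_differentiable[OF smooth_transition]

lemma overlap_transition_iff:
  assumes "c \<in> A" "d \<in> A" "e \<in> A" "y \<in> overlap c d"
  shows "transition c d y \<in> overlap d e \<longleftrightarrow> y \<in> overlap c e"
  using transition_point[OF assms(1,2,4)] overlap_subset_img[OF assms(1), of d] assms(4)
  by (auto simp: overlap_iff assms)

lemma fd_transition_trans:
  assumes "c \<in> A" "d \<in> A" "e \<in> A" and y: "y \<in> overlap c d" "y \<in> overlap c e"
  shows "fd (transition c e) y v = fd (transition d e) (transition c d y) (fd (transition c d) y v)"
proof -
  have "fd (transition c e) y = fd (\<lambda>z. transition d e (transition c d z)) y"
  proof (rule fd_cong)
    show "open (overlap c d \<inter> overlap c e)" by (intro open_Int open_overlap assms)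
    show "transition c e z = transition d e (transition c d z)" if "z \<in> overlap c d \<inter> overlap c e" for z
      using transition_point(1)[OF assms(1,2), of z] that by (simp add: transition_def)
  qed (use y in simp)
  moreover have "transition c d y \<in> overlap d e"
    by (simp add: overlap_transition_iff assms)
  ultimately show ?thesis
    using fd_compose(1)[OF diff_transition[OF assms(1,2) y(1)] diff_transition[OF assms(2,3)]] by simp
qed

lemma fd_transition_inverse:
  assumes "c \<in> A" "d \<in> A" and y: "y \<in> overlap c d"
  shows "fd (transition d c) (transition c d y) (fd (transition c d) y v) = v"
proof -
  have yc: "y \<in> overlap c c"
    using y chart_param(1)[of y c] by (simp add: overlap_iff assms(1))
  have "fd (transition c c) y = fd (\<lambda>z. z) y"
    by (rule fd_cong[OF open_overlap[OF assms(1,1)] yc])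
      (simp add: transition_def overlap_iff assms chart_param)
  then show ?thesis using fd_transition_trans[OF assms(1,2,1) y yc, of v] by simp
qed

text \<open>For each foliated chart e, the derivative of the transition from c to e factors through
  d, so the defining conditions of both sides agree one by one.\<close>

lemma vertical_transition:
  assumes "c \<in> A" "d \<in> A" "F \<subseteq> A" and y: "y \<in> overlap c d"
  shows "u \<in> vertical W F c y \<longleftrightarrow> fd (transition c d) y u \<in> vertical W F d (transition c d y)"
proof -
  have "(y \<in> overlap c e \<longrightarrow> fd (transition c e) y u \<in> W) \<longleftrightarrow>
      (transition c d y \<in> overlap d e \<longrightarrow>
        fd (transition d e) (transition c d y) (fd (transition c d) y u) \<in> W)" if "e \<in> F" for e
    using fd_transition_trans[OF assms(1,2) _ y, of e u]
      overlap_transition_iff[OF assms(1,2) _ y, of e] subsetD[OF assms(3) that] by auto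
  then show ?thesis unfolding vertical_def by simp
qed

text \<open>Transition maps are isometries between the coordinate expressions of \<open>g\<close>,
  so composing with one keeps a submersion Riemannian; the inverse transition supplies surjectivity
  and carries kernel vectors back. This moves the submersion from the chart where it is given to the
  chart where fatness is tested.\<close>

lemma submersion_transition:
  assumes g: "riemannian_metric A g" and c: "c \<in> A" and d: "d \<in> A"
    and sub: "riemannian_submersion (img d) (g d) Q h \<pi>"
  shows "riemannian_submersion (overlap c d) (g c) Q h (\<lambda>y. \<pi> (transition c d y))"
    and "y \<in> overlap c d \<Longrightarrow>
      fd (\<lambda>y. \<pi> (transition c d y)) y u = fd \<pi> (transition c d y) (fd (transition c d) y u)"
proof -
  let ?\<tau> = "transition c d"
  note S = open_overlap[OF c d] and \<tau> = transition_point[OF c d]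
  have im: "?\<tau> ` overlap c d \<subseteq> img d" using \<tau>(4) by blast
  have sub': "smooth_on (img d) \<pi>" "\<pi> ` img d \<subseteq> Q"
    "\<And>y. y \<in> img d \<Longrightarrow> range (fd \<pi> y) = Q" "\<And>y. y \<in> img d \<Longrightarrow> inner_product_on Q (h (\<pi> y))"
    "\<And>u v. u \<in> Q \<Longrightarrow> v \<in> Q \<Longrightarrow> smooth_on (img d) (\<lambda>y. h (\<pi> y) u v)"
    and iso: "\<And>y u v. y \<in> img d \<Longrightarrow> u \<in> horizontal (g d) (\<lambda>_. {w. fd \<pi> y w = 0}) y
      \<Longrightarrow> v \<in> horizontal (g d) (\<lambda>_. {w. fd \<pi> y w = 0}) y \<Longrightarrow> h (\<pi> y) (fd \<pi> y u) (fd \<pi> y v) = g d y u v"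
    using sub unfolding riemannian_submersion_def Let_def by blast+
  show D: "fd (\<lambda>y. \<pi> (?\<tau> y)) y u = fd \<pi> (?\<tau> y) (fd ?\<tau> y u)" if "y \<in> overlap c d" for y u
    by (rule fd_compose(1)[OF diff_transition[OF c d that] smooth_on_imp_differentiable[OF sub'(1) \<tau>(4)[OF that]]])
  have inv: "fd ?\<tau> y (fd (transition d c) (?\<tau> y) w) = w" if "y \<in> overlap c d" for y w
    using fd_transition_inverse[OF d c \<tau>(2)[OF that], of w] by (simp add: \<tau>(3)[OF that])
  show "riemannian_submersion (overlap c d) (g c) Q h (\<lambda>y. \<pi> (?\<tau> y))"
    unfolding riemannian_submersion_def Let_def
  proof (intro conjI ballI)
    show "smooth_on (overlap c d) (\<lambda>y. \<pi> (?\<tau> y))"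
      by (rule smooth_onI) (rule ck_on_compose[OF S smooth_onD[OF smooth_transition[OF c d]] smooth_onD[OF sub'(1)] im])
    show "(\<lambda>y. \<pi> (?\<tau> y)) ` overlap c d \<subseteq> Q" using im sub'(2) by blast
    show "smooth_on (overlap c d) (\<lambda>y. h (\<pi> (?\<tau> y)) u v)" if "u \<in> Q" "v \<in> Q" for u v
      by (rule smooth_onI) (rule ck_on_compose[OF S smooth_onD[OF smooth_transition[OF c d]]
          smooth_onD[OF sub'(5)[OF that]] im])
  next
    fix q assume "q \<in> (\<lambda>y. \<pi> (?\<tau> y)) ` overlap c d"
    then show "inner_product_on Q (h q)" using sub'(4) im by blast
  next
    fix y assume y: "y \<in> overlap c d"
    show "range (fd (\<lambda>y. \<pi> (?\<tau> y)) y) = Q"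
    proof -
      have "fd \<pi> (?\<tau> y) w \<in> range (fd (\<lambda>y. \<pi> (?\<tau> y)) y)" for w
        using D[OF y, of "fd (transition d c) (?\<tau> y) w"] inv[OF y, of w] by (metis rangeI)
      then show ?thesis using sub'(3)[OF \<tau>(4)[OF y]] D[OF y] by auto
    qed
    fix u v
    let ?H = "horizontal (g c) (\<lambda>_. {w. fd (\<lambda>y. \<pi> (?\<tau> y)) y w = 0}) y"
    assume uv: "u \<in> ?H" "v \<in> ?H"
    have iso_\<tau>: "g c y a b = g d (?\<tau> y) (fd ?\<tau> y a) (fd ?\<tau> y b)" for a b
      using g c d y unfolding riemannian_metric_def by blast
    have hor: "fd ?\<tau> y a \<in> horizontal (g d) (\<lambda>_. {w. fd \<pi> (?\<tau> y) w = 0}) (?\<tau> y)" if "a \<in> ?H" for a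
      unfolding horizontal_def
    proof (clarify)
      fix w assume "fd \<pi> (?\<tau> y) w = 0"
      then have "g c y a (fd (transition d c) (?\<tau> y) w) = 0"
        using that by (simp add: horizontal_def D[OF y] inv[OF y])
      then show "g d (?\<tau> y) (fd ?\<tau> y a) w = 0" by (simp add: iso_\<tau> inv[OF y])
    qed
    show "h (\<pi> (?\<tau> y)) (fd (\<lambda>y. \<pi> (?\<tau> y)) y u) (fd (\<lambda>y. \<pi> (?\<tau> y)) y v) = g c y u v"
      by (simp add: D[OF y] iso[OF \<tau>(4)[OF y] hor[OF uv(1)] hor[OF uv(2)]] iso_\<tau>)
  qed
qed

lemma smooth_function_continuous:
  assumes "smooth_function A \<phi>"
  shows "continuous_on UNIV \<phi>"
proof (rule continuous_at_imp_continuous_on, rule ballI)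
  fix p :: 'm
  obtain c where c: "c \<in> A" "p \<in> fst c" using atlas unfolding smooth_structure_def by blast
  obtain c' where h: "open (fst c)" "homeomorphism (fst c) (img c) (snd c) c'"
    using chart_homeomorphism[OF c(1)] .
  have "continuous_on (img c) (\<phi> \<circ> param c)"
    using assms c(1) unfolding smooth_function_def by (blast intro: ck_on_imp_continuous_on smooth_onD)
  then have "continuous_on (fst c) (\<lambda>q. (\<phi> \<circ> param c) (snd c q))"
    by (rule continuous_on_compose2) (use h(2) in \<open>auto simp: homeomorphism_def\<close>)
  then have "continuous_on (fst c) \<phi>"
    by (rule continuous_on_eq) (simp add: param_chart[OF c(1)])
  then show "isCont \<phi> p" using h(1) c(2) by (simp add: continuous_on_eq_continuous_at)
qed

end

section \<open>Fatness at a minimum of the scaling function\<close>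

theorem theorem2:
  fixes A F :: "('m::{t2_space, second_countable_topology}, 'e::euclidean_space) chart set"
    and W :: "'e set"
    and g\<^sub>0 :: "('m, 'e) chart \<Rightarrow> 'e local_metric"
    and \<phi> :: "'m \<Rightarrow> real"
  assumes "compact (UNIV :: 'm set)"
    and "smooth_structure A"
    and "riemannian_metric A g\<^sub>0"
    and "riemannian_foliation A W F g\<^sub>0"
    and "totally_geodesic_leaves A W F g\<^sub>0"
    and "basic_function A W F \<phi>"
    and "positive_sectional_curvature A (rescaled_metric W F g\<^sub>0 \<phi>)"
  shows "\<exists>p. fat_point A W F g\<^sub>0 p"
proof -
  interpret smooth_atlas A by unfold_locales (rule assms(2))
  have F: "F \<subseteq> A" and loc: "\<And>p. \<exists>c\<in>A. p \<in> fst c \<and>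
        (\<exists>\<pi> h. riemannian_submersion (img c) (g\<^sub>0 c) (orthogonal_comp W) h \<pi> \<and>
           (\<forall>x\<in>img c. {u. fd \<pi> x u = 0} = vertical W F c x))"
    using assms(4) unfolding riemannian_foliation_def foliation_def by blast+
  have \<phi>: "smooth_function A \<phi>" using assms(6) unfolding basic_function_def by blast
  obtain p where p: "\<And>q. \<phi> p \<le> \<phi> q"
    using continuous_attains_inf[OF assms(1) _ smooth_function_continuous[OF \<phi>]] by auto
  have "fat_point A W F g\<^sub>0 p"
    unfolding fat_point_def Let_def
  proof (intro ballI impI notI)
    fix c u w
    let ?x = "snd c p" and ?V = "vertical W F c" and ?G = "g\<^sub>0 c"
    let ?G' = "rescaled_metric W F g\<^sub>0 \<phi> c"
    assume c: "c \<in> A" and pc: "p \<in> fst c" and u: "u \<in> horizontal ?G ?V ?x" and w: "w \<in> ?V ?x"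
      and nz: "u \<noteq> 0 \<and> w \<noteq> 0" and A0: "oneill_adjoint ?G ?V ?x u w = 0"
    obtain d \<pi>\<^sub>0 h where d: "d \<in> A" "p \<in> fst d"
      and sub\<^sub>0: "riemannian_submersion (img d) (g\<^sub>0 d) (orthogonal_comp W) h \<pi>\<^sub>0"
      and ker: "\<And>x. x \<in> img d \<Longrightarrow> {u. fd \<pi>\<^sub>0 x u = 0} = vertical W F d x"
      using loc[of p] by blast
    define S where "S = overlap c d"
    define \<pi> where "\<pi> = (\<lambda>y. \<pi>\<^sub>0 (transition c d y))"
    define f where "f y = exp (2 * \<phi> (param c y))" for y
    have S: "open S" "S \<subseteq> img c" "?x \<in> S"
      using open_overlap[OF c d(1)] overlap_subset_img[OF c] pc d(2) by (auto simp: S_def overlap_def)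
    have met: "local_riemannian_metric (img c) ?G"
      using assms(3) c unfolding riemannian_metric_def by blast
    interpret submersion_metric S ?G "orthogonal_comp W" h \<pi>
    proof unfold_locales
      show "local_riemannian_metric S ?G"
        using met S(2) ck_on_subset unfolding local_riemannian_metric_def smooth_on_def by blast
      show "riemannian_submersion S ?G (orthogonal_comp W) h \<pi>"
        unfolding S_def \<pi>_def by (rule submersion_transition(1)[OF assms(3) c d(1) sub\<^sub>0])
    qed (rule S(1) subspace_orthogonal_comp)+
    have V: "?V y = {u. fd \<pi> y u = 0}" if "y \<in> S" for y
    proof -
      have "fd \<pi> y u = 0 \<longleftrightarrow> u \<in> ?V y" for u
        using that ker[OF transition_point(4)[OF c d(1)], of y] unfolding S_def \<pi>_def
        by (auto simp: submersion_transition(2)[OF assms(3) c d(1) sub\<^sub>0] vertical_transition[OF c d(1) F])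
      then show ?thesis by blast
    qed
    have sf: "smooth_on S f"
    proof (rule smooth_onI)
      fix k
      have "ck_on k S (\<phi> \<circ> param c)"
        using \<phi> c S(2) ck_on_subset unfolding smooth_function_def smooth_on_def by blast
      then have "ck_on k S (\<lambda>y. 2 * (\<phi> \<circ> param c) y)"
        by (intro ck_on_mult[OF S(1)] ck_on_const)
      then have "ck_on k S (\<lambda>y. exp (2 * (\<phi> \<circ> param c) y))"
        by (rule ck_on_compose[OF S(1) _ ck_on_exp]) simp
      then show "ck_on k S f" by (simp add: f_def[abs_def])
    qed
    interpret warped_submersion S ?G "orthogonal_comp W" h \<pi> f ?G'
    proof unfold_locales
      show "?G' y u v = ?G y (hor u y) (hor v y) + f y * ?G y (ver u y) (ver v y)" if "y \<in> S" for y u v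
        using vpart_eq[where V="?V", OF that V[OF that]]
        by (simp add: rescaled_metric_def Let_def f_def)
    qed (use sf in \<open>auto simp: f_def\<close>)
    have hu: "hor_vec ?x u" using u by (simp add: horizontal_def hor_vec_def V[OF S(3)])
    have w0: "fd \<pi> ?x w = 0" using w V[OF S(3)] by simp
    have min: "f ?x \<le> f y" for y
      using p by (simp add: f_def param_chart[OF c pc])
    have "?G' ?x (curvature ?G' ?x w u u) w \<le> 0"
    proof (rule warped_curvature_nonpos[OF S(3) _ w0 hu])
      show "fd \<pi> y (levi_civita ?G \<xi> \<eta> y) = 0" if "vert \<xi>" "vert \<eta>" "y \<in> S" for \<xi> \<eta> y
      proof -
        have "open S \<and> S \<subseteq> img c \<and> smooth_on S \<xi> \<and> smooth_on S \<eta> \<and> (\<forall>x\<in>S. \<xi> x \<in> ?V x \<and> \<eta> x \<in> ?V x)"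
          by (simp add: S(1,2) vertD[OF that(1)] vertD[OF that(2)] V)
        from assms(5)[unfolded totally_geodesic_leaves_def, rule_format, OF c this that(3)]
        show ?thesis by (simp add: V[OF that(3)])
      qed
      show "?G ?x w (lie_bracket (hor u) (hor v) ?x) = 0" if "hor_vec ?x v" for v
        by (rule oneill_adjoint_eq_0D[where V="?V", OF S(3) V w0 A0 that])
    qed (rule fd_minimum[OF S(1,3) smooth_onD[OF sf] min])+
    moreover have "0 < ?G' ?x (curvature ?G' ?x w u u) w"
    proof -
      \<comment> \<open>Orthogonality has two uses: w = r u would give G' w w = r G' u w = 0, so the
        vectors are independent, and the Gram determinant becomes the positive number G' w w * G' u
        u, so the curvature has the sign of its numerator.\<close>
      have orth: "?G' ?x w u = 0" "?G' ?x u w = 0"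
        using W.G_vert_hor[OF S(3) _ w0] W.G_hor_vert[OF _ w0] hu W_hor_vec[OF S(3)] by simp_all
      have pos: "0 < ?G' ?x w w" "0 < ?G' ?x u u"
        using inner_product_onD(4)[OF W.ip[OF S(3)]] nz by auto
      have "w \<notin> span {u}"
      proof
        assume "w \<in> span {u}"
        then obtain r where "w = r *\<^sub>R u" by (auto simp: span_singleton)
        then show False using orth(2) pos(1) linear_scale[OF W.linear_G(1)[OF S(3)], of r u w] by simp
      qed
      moreover from this have "w \<noteq> u" using span_base[of u "{u}"] by auto
      ultimately have "w \<noteq> u \<and> independent {w, u}" using nz by (simp add: independent_insert)
      then have "0 < sectional_curvature ?G' ?x w u"
        using assms(7) c S unfolding positive_sectional_curvature_def by blast
      then show ?thesis using mult_pos_pos[OF pos] by (auto simp: sectional_curvature_def orth zero_less_divide_iff)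
    qed
    ultimately show False by simp
  qed
  then show ?thesis ..
qed

end
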